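(* Let $q>1$ be an odd integer and let $R$ be an integral ring which is not isomorphic to $\mathbb{F}_3$, $\mathbb{F}_5$ or $\mathbb{F}_9$. Then the following seven statements are equivalent, where in each of (1)--(4) one may read either "for each $n\in\mathbb{N}$" or "for some $n\in\mathbb{N}$" (all resulting statements being equivalent to each other and to (5), (6), (7)): (1) For each (for some) $n\in\mathbb{N}$, every matrix in $\mathbb{M}_n(R)$ is a sum of an idempotent matrix and a $q$-potent matrix. (2) For each (for some) $n\in\mathbb{N}$, every matrix in $\mathbb{M}_n(R)$ is a sum of a nilpotent matrix and a $q$-potent matrix. (3) For each (for some) $n\in\mathbb{N}$, every matrix in $\mathbb{M}_n(R)$ is a sum of a tripotent matrix and a $q$-potent matrix. (4) For each (for some) $n\in\mathbb{N}$, every matrix in $\mathbb{M}_n(R)$ is a sum or a difference of a $q$-potent matrix and an idempotent matrix (i.e. has the form $B+E$ or $B-E$ with $B$ $q$-potent and $E$ idempotent). (5) Every element of $R$ is the sum of a $q$-potent and a tripotent. (6) Every element of $R$ is the sum or the difference of a $q$-potent and an idempotent. (7) $R$ is a finite field such that $(|R|-1)\mid(q-1)$.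
   Context: $\mathbb{N}$ is the set of positive integers. An integral ring is a non-zero commutative ring with $1$ having no non-trivial zero divisors. $\mathbb{M}_n(R)$ is the ring of $n\times n$ matrices over $R$, and $\mathbb{F}_Q$ is the finite field with $Q$ elements. An element $t$ of a ring is idempotent if $t^2=t$, tripotent if $t^3=t$, and $q$-potent if $t^q=t$. *)

theory Defs
  imports "Jordan_Normal_Form.Matrix" "HOL-Algebra.Algebraic_Closure_Type"
begin

definition potent :: "('a, 'm) ring_scheme \<Rightarrow> nat \<Rightarrow> 'a \<Rightarrow> bool" where
  "potent S k t \<longleftrightarrow> t \<in> carrier S \<and> t [^]\<^bsub>S\<^esub> k = t"

abbreviation idempotent_elem :: "('a, 'm) ring_scheme \<Rightarrow> 'a \<Rightarrow> bool" where
  "idempotent_elem S \<equiv> potent S 2"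

abbreviation tripotent_elem :: "('a, 'm) ring_scheme \<Rightarrow> 'a \<Rightarrow> bool" where
  "tripotent_elem S \<equiv> potent S 3"

definition nilpotent_elem :: "('a, 'm) ring_scheme \<Rightarrow> 'a \<Rightarrow> bool" where
  "nilpotent_elem S t \<longleftrightarrow> t \<in> carrier S \<and> (\<exists>k::nat. k > 0 \<and> t [^]\<^bsub>S\<^esub> k = \<zero>\<^bsub>S\<^esub>)"

definition every_sum ::
    "('a, 'm) ring_scheme \<Rightarrow> ('a \<Rightarrow> bool) \<Rightarrow> ('a \<Rightarrow> bool) \<Rightarrow> bool" where
  "every_sum S P Q \<longleftrightarrow> (\<forall>a\<in>carrier S. \<exists>x y. P x \<and> Q y \<and> a = x \<oplus>\<^bsub>S\<^esub> y)"

text \<open>The choice between sum and difference may depend on the element.\<close>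

definition every_sum_or_diff ::
    "('a, 'm) ring_scheme \<Rightarrow> ('a \<Rightarrow> bool) \<Rightarrow> ('a \<Rightarrow> bool) \<Rightarrow> bool" where
  "every_sum_or_diff S P Q \<longleftrightarrow>
     (\<forall>a\<in>carrier S. \<exists>x y. P x \<and> Q y \<and> (a = x \<oplus>\<^bsub>S\<^esub> y \<or> a = x \<ominus>\<^bsub>S\<^esub> y))"

abbreviation base_ring :: "'a::idom itself \<Rightarrow> 'a ring" where
  "base_ring _ \<equiv> ring_of_type_algebra"

abbreviation matrix_ring :: "'a::idom itself \<Rightarrow> nat \<Rightarrow> 'a mat ring" where
  "matrix_ring ty n \<equiv> ring_mat ty n ()"

text \<open>
  The finite field with \<open>Q\<close> elements is determined up to isomorphism by its order, and every
  finite ring has a copy with carrier in \<^typ>\<open>nat\<close>; so being isomorphic to it is expressed as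
  being isomorphic to some field of order \<open>Q\<close> carried by natural numbers.
\<close>

definition iso_to_GF :: "('a, 'm) ring_scheme \<Rightarrow> nat \<Rightarrow> bool" where
  "iso_to_GF R Q \<longleftrightarrow> (\<exists>F :: nat ring. field F \<and> Coset.order F = Q \<and> R \<simeq> F)"

definition all_equivalent :: "bool list \<Rightarrow> bool" where
  "all_equivalent xs \<longleftrightarrow> (\<forall>x\<in>set xs. \<forall>y\<in>set xs. x \<longleftrightarrow> y)"

end

theory Submission
  imports Defs "HOL-Library.Function_Algebras"
begin

text \<open>
  Every condition is compared with the condition \<open>F\<close> that \<open>a\<^sup>q = a\<close> for all \<open>a\<close> in \<open>R\<close>. It is
  equivalent to the last one, since a domain satisfying \<open>F\<close> is finite, hence a field, and the
  multiplicative group of a finite field is cyclic (\<open>all_potent_iff\<close>).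

  From the conditions to \<open>F\<close>. Suppose that a scalar matrix \<open>a 1\<close> is a sum \<open>E + B\<close> with \<open>B\<close>
  \<open>q\<close>-potent. On an eigenvector of \<open>E\<close> for the eigenvalue \<open>l\<close>, \<open>B\<close> acts as \<open>a - l\<close>, so that
  \<open>a - l\<close> is \<open>q\<close>-potent. If \<open>E\<close> is nilpotent, \<open>l = 0\<close> is available and \<open>F\<close> follows. If \<open>E\<close> is
  tripotent, \<open>l\<close> is \<open>0\<close>, \<open>1\<close> or \<open>-1\<close>, and one learns, as from the conditions on elements of
  \<open>R\<close>, that one of \<open>a\<close>, \<open>a + 1\<close>, \<open>a - 1\<close> is \<open>q\<close>-potent. Hence \<open>R\<close> is a finite field covered by
  three translates of \<open>H \<union> {0}\<close>, where \<open>H\<close> is the group of nonzero \<open>q\<close>-potents, and \<open>-1\<close> is in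
  \<open>H\<close>. If \<open>H\<close> is a proper subgroup, counting shows that it has index 2 and that every element
  outside \<open>H \<union> {0}\<close> has exactly one neighbour \<open>a \<plusminus> 1\<close> in \<open>H\<close>; it follows that the squares of
  \<open>H\<close> form, together with \<open>0\<close>, a clique of the Paley graph, too large for it unless the order
  of the field is 5 or 9 (\<open>potent_translates_cover\<close>).

  From \<open>F\<close> to the conditions. A matrix over a finite field \<open>R\<close> makes the column vectors a
  torsion module over the polynomial ring, which is a direct sum of cyclic modules
  (\<open>split_off_cyclic\<close>), so only companion matrices, acting by \<open>e i \<mapsto> e (i + 1)\<close> except on the
  last basis vector, have to be decomposed. The basis is cut into pairs of neighbours. The
  nilpotent or idempotent summand absorbs the arrows from one pair to the next, so that the
  other summand is pieced together from blocks of size at most 2 whose eigenvalues lie in \<open>R\<close>.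
  The last block has to account for the trace. In the idempotent case and odd characteristic
  it is given two distinct eigenvalues other than \<open>-1\<close>, for which \<open>R\<close> must have more than
  three elements. In characteristic 2 there are sometimes too few eigenvalues, but as \<open>q\<close> is
  odd, Jordan blocks of size 2 are then \<open>q\<close>-potent for the eigenvalue \<open>1\<close>
  (\<open>nilpotent_plus_potent\<close>, \<open>idempotent_plus_potent\<close>).
\<close>


section \<open>Covering a finite field by translates of a subgroup\<close>

text \<open>
  Squaring identifies only \<open>a\<close> and \<open>- a\<close>, so the set is covered by the images of two sections
  of it.
\<close>

lemma card_le_twice_card_squares:
  fixes A :: "'f::idom set"
  assumes "finite A"
  shows "card A \<le> 2 * card ((\<lambda>a. a\<^sup>2) ` A)"
proof -
  let ?T = "(\<lambda>a. a\<^sup>2) ` A"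
  define s where "s t = (SOME a. a\<^sup>2 = t)" for t :: 'f
  have "A \<subseteq> s ` ?T \<union> (\<lambda>t. - s t) ` ?T"
  proof
    fix a assume a: "a \<in> A"
    have "(s (a\<^sup>2))\<^sup>2 = a\<^sup>2"
      unfolding s_def by (rule someI) simp
    then have "a = s (a\<^sup>2) \<or> a = - s (a\<^sup>2)"
      by (metis power2_eq_iff)
    then show "a \<in> s ` ?T \<union> (\<lambda>t. - s t) ` ?T"
      using a by blast
  qed
  then have "card A \<le> card (s ` ?T \<union> (\<lambda>t. - s t) ` ?T)"
    using assms by (intro card_mono) auto
  also have "\<dots> \<le> card (s ` ?T) + card ((\<lambda>t. - s t) ` ?T)"
    by (rule card_Un_le)
  also have "\<dots> \<le> card ?T + card ?T"
    using assms by (intro add_mono card_image_le) auto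
  finally show ?thesis by simp
qed

text \<open>
  The case to be excluded: a proper subgroup \<open>H\<close> of the multiplicative group of a finite
  field, containing \<open>-1\<close>, such that \<open>H \<union> {0}\<close> and its translates by \<open>1\<close> and \<open>-1\<close> cover the
  field. It does occur, with \<open>H\<close> the nonzero squares, for the fields of order 5 and 9.
\<close>

locale covering_subgroup =
  fixes H :: "'f::field set"
  assumes fin: "finite (UNIV :: 'f set)"
    and zero_notin: "0 \<notin> H"
    and neg_one: "-1 \<in> H"
    and mult_closed: "x \<in> H \<Longrightarrow> y \<in> H \<Longrightarrow> x * y \<in> H"
    and inverse_closed: "x \<in> H \<Longrightarrow> inverse x \<in> H"
    and cover: "x \<in> insert 0 H \<or> x + 1 \<in> insert 0 H \<or> x - 1 \<in> insert 0 H"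
    and proper: "insert 0 H \<noteq> UNIV"
begin

definition N where "N = - insert 0 H"

lemma finite_set [simp]: "finite (S :: 'f set)"
  using fin by (rule rev_finite_subset) simp

lemma one: "1 \<in> H"
  using mult_closed[OF neg_one neg_one] by simp

lemma neg_closed: "x \<in> H \<Longrightarrow> - x \<in> H"
  using mult_closed[OF neg_one] by fastforce

lemma in_N_iff: "x \<in> N \<longleftrightarrow> x \<noteq> 0 \<and> x \<notin> H"
  by (auto simp: N_def)

lemma N_mult_H: "x \<in> N \<Longrightarrow> y \<in> H \<Longrightarrow> x * y \<in> N"
  using mult_closed[of "x * y" "inverse y"] inverse_closed[of y] zero_notin
  by (cases "y = 0") (auto simp: in_N_iff mult.assoc)

lemma H_mult_N: "y \<in> H \<Longrightarrow> x \<in> N \<Longrightarrow> y * x \<in> N"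
  using N_mult_H[of x y] by (simp add: mult.commute)

lemma neg_N: "x \<in> N \<Longrightarrow> - x \<in> N"
  using N_mult_H[OF _ neg_one, of x] by simp

lemma inverse_N: "x \<in> N \<Longrightarrow> inverse x \<in> N"
  using inverse_closed[of "inverse x"] by (auto simp: in_N_iff)

lemma N_nonempty: "\<exists>g. g \<in> N"
  using proper by (auto simp: N_def)

lemma card_H_pos: "card H > 0"
  using one by (auto simp: card_gt_0_iff)

lemma N_neighbour: "x \<in> N \<Longrightarrow> x + 1 \<in> H - {1} \<or> x - 1 \<in> H - {-1}"
  using cover[of x] one neg_one by (auto simp: in_N_iff add_eq_0_iff minus_equation_iff[of x])

text \<open>
  Of the \<open>2 |H| + 2\<close> elements \<open>p - 1\<close> and \<open>p + 1\<close> with \<open>p\<close> in \<open>H \<union> {0}\<close>, the ones with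
  \<open>p = 0\<close>, \<open>1 - 1\<close> and \<open>-1 + 1\<close> are not in \<open>N\<close>. Losing four of them leaves \<open>|N| \<le> 2 |H| - 2\<close>,
  which is what rules out an index above 2.
\<close>

lemma N_subset: "N \<subseteq> (\<lambda>p. p - 1) ` (H - {1}) \<union> (\<lambda>p. p + 1) ` (H - {-1})"
proof
  fix x assume "x \<in> N"
  then show "x \<in> (\<lambda>p. p - 1) ` (H - {1}) \<union> (\<lambda>p. p + 1) ` (H - {-1})"
    using N_neighbour[of x] by (force simp: image_iff)
qed

lemma card_coset: "g \<in> N \<Longrightarrow> card ((\<lambda>h. g * h) ` H) = card H"
  by (intro card_image) (auto simp: inj_on_def in_N_iff)

text \<open>
  Two disjoint cosets inside \<open>N\<close> would have \<open>2 |H|\<close> elements, more than \<open>N\<close> has room for.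
  Hence \<open>H\<close> has index 2, and behaves like the group of nonzero squares.
\<close>

lemma N_eq_coset:
  assumes g: "g \<in> N"
  shows "N = (\<lambda>h. g * h) ` H"
proof (rule ccontr)
  assume ne: "N \<noteq> (\<lambda>h. g * h) ` H"
  have sub: "(\<lambda>h. x * h) ` H \<subseteq> N" if "x \<in> N" for x
    using N_mult_H[OF that] by auto
  then obtain g' where g': "g' \<in> N" "g' \<notin> (\<lambda>h. g * h) ` H"
    using ne g by blast
  have disj: "(\<lambda>h. g * h) ` H \<inter> (\<lambda>h. g' * h) ` H = {}"
  proof -
    have False if "h \<in> H" "h' \<in> H" "g * h = g' * h'" for h h'
    proof -
      have "g' = g * (h * inverse h')"
        using that zero_notin by (auto simp: field_simps)
      then show False
        using g'(2) mult_closed[OF that(1) inverse_closed[OF that(2)]] by blast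
    qed
    then show ?thesis by auto
  qed
  have "2 * card H = card ((\<lambda>h. g * h) ` H \<union> (\<lambda>h. g' * h) ` H)"
    using card_coset[OF g] card_coset[OF g'(1)] disj by (subst card_Un_disjoint) auto
  also have "\<dots> \<le> card N"
    using sub[OF g] sub[OF g'(1)] by (intro card_mono) auto
  also have "\<dots> \<le> card ((\<lambda>p. p - 1) ` (H - {1}) \<union> (\<lambda>p. p + 1) ` (H - {-1}))"
    by (intro card_mono N_subset) auto
  also have "\<dots> \<le> card ((\<lambda>p. p - 1) ` (H - {1})) + card ((\<lambda>p. p + 1) ` (H - {-1}))"
    by (rule card_Un_le)
  also have "\<dots> \<le> card (H - {1}) + card (H - {-1})"
    by (intro add_mono card_image_le) auto
  also have "\<dots> = 2 * (card H - 1)"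
    using one neg_one by (simp add: card_Diff_singleton)
  finally show False using card_H_pos by linarith
qed

lemma card_N: "card N = card H"
  using N_nonempty N_eq_coset card_coset by metis

lemma N_mult_N: "x \<in> N \<Longrightarrow> y \<in> N \<Longrightarrow> x * y \<in> H"
proof -
  assume x: "x \<in> N" and "y \<in> N"
  then have "y \<in> (\<lambda>h. inverse x * h) ` H"
    using N_eq_coset[OF inverse_N[OF x]] by simp
  then show ?thesis using x by (auto simp: in_N_iff mult.assoc[symmetric])
qed

lemma card_UNIV_eq: "card (UNIV :: 'f set) = 2 * card H + 1"
proof -
  have "0 \<notin> H \<union> N" and "H \<inter> N = {}"
    using zero_notin by (auto simp: N_def)
  then have "card (insert 0 (H \<union> N)) = 2 * card H + 1"
    using card_N by (simp add: card_Un_disjoint)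
  moreover have "insert 0 (H \<union> N) = UNIV" by (auto simp: N_def)
  ultimately show ?thesis by metis
qed

definition D where "D = {x \<in> N. x + 1 \<in> H}"

text \<open>
  Scaling shows that every \<open>g \<noteq> 0\<close> has the same number of representations \<open>g = x - y\<close> with \<open>x\<close>
  in \<open>H\<close> and \<open>y\<close> in \<open>N\<close>: multiplication by \<open>g\<close> does it for \<open>g\<close> in \<open>H\<close>, and for \<open>g\<close> in \<open>N\<close> it
  interchanges the two cosets, which the sign repairs because \<open>-1\<close> is in \<open>H\<close>. As \<open>D\<close> counts
  the representations of \<open>1\<close>, distributing the \<open>|H| |N| = |H|\<^sup>2\<close> pairs over the \<open>2 |H|\<close>
  nonzero differences gives the claim.
\<close>

lemma twice_card_D: "2 * card D = card H"
proof -
  let ?X = "\<lambda>g. {(x, y). x \<in> H \<and> y \<in> N \<and> x - y = g}"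
  have fin_prod [simp]: "finite (S :: ('f \<times> 'f) set)" for S
    using finite_cartesian_product[OF fin fin] by (auto intro: finite_subset[OF subset_UNIV])
  have X1: "card (?X 1) = card D"
  proof -
    have "?X 1 = (\<lambda>y. (y + 1, y)) ` D"
      by (auto simp: D_def image_iff algebra_simps)
    then show ?thesis
      by (simp add: card_image inj_on_def)
  qed
  have Xg: "card (?X g) = card D" if "g \<noteq> 0" for g
  proof (cases "g \<in> H")
    case True
    have "?X g = (\<lambda>(x, y). (g * x, g * y)) ` ?X 1"
    proof (intro equalityI subsetI)
      fix p assume "p \<in> ?X g"
      then obtain x y where p: "p = (x, y)" "x \<in> H" "y \<in> N" "x - y = g" by auto
      have "(inverse g * x, inverse g * y) \<in> ?X 1"
        using p mult_closed inverse_closed[OF True] H_mult_N that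
        by (auto simp: right_diff_distrib[symmetric])
      then show "p \<in> (\<lambda>(x, y). (g * x, g * y)) ` ?X 1"
        using that p(1) by (force simp: image_iff mult.assoc[symmetric])
    next
      fix p assume "p \<in> (\<lambda>(x, y). (g * x, g * y)) ` ?X 1"
      then show "p \<in> ?X g"
        using mult_closed[OF True] H_mult_N[OF True]
        by (auto simp: right_diff_distrib[symmetric])
    qed
    moreover have "inj_on (\<lambda>(x, y). (g * x, g * y)) (?X 1)"
      using that by (auto simp: inj_on_def)
    ultimately have "card (?X g) = card (?X 1)" by (simp only: card_image)
    then show ?thesis using X1 by (rule trans)
  next
    case False
    then have g: "g \<in> N" using that by (simp add: in_N_iff)
    have "?X g = (\<lambda>(x, y). (- (g * y), - (g * x))) ` ?X 1"
    proof (intro equalityI subsetI)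
      fix p assume "p \<in> ?X g"
      then obtain x y where p: "p = (x, y)" "x \<in> H" "y \<in> N" "x - y = g" by auto
      have "- (inverse g * y) - - (inverse g * x) = inverse g * (x - y)"
        by (simp add: algebra_simps)
      then have "- (inverse g * y) - - (inverse g * x) = 1"
        using p that by simp
      then have "(- (inverse g * y), - (inverse g * x)) \<in> ?X 1"
        using p N_mult_N[OF inverse_N[OF g] p(3)] N_mult_H[OF inverse_N[OF g] p(2)]
        by (simp only: mem_Collect_eq prod.case neg_closed neg_N simp_thms)
      moreover have "p = (\<lambda>(x, y). (- (g * y), - (g * x))) (- (inverse g * y), - (inverse g * x))"
        using that p(1) by (simp add: mult.assoc[symmetric])
      ultimately show "p \<in> (\<lambda>(x, y). (- (g * y), - (g * x))) ` ?X 1"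
        by (rule rev_image_eqI)
    next
      fix p assume "p \<in> (\<lambda>(x, y). (- (g * y), - (g * x))) ` ?X 1"
      then obtain x y where p: "p = (- (g * y), - (g * x))" "x \<in> H" "y \<in> N" "x - y = 1"
        by auto
      have "- (g * y) - - (g * x) = g * (x - y)" by (simp add: algebra_simps)
      then show "p \<in> ?X g"
        using p N_mult_N[OF g p(3)] N_mult_H[OF g p(2)]
        by (simp only: mem_Collect_eq prod.case neg_closed neg_N simp_thms mult_1_right)
    qed
    moreover have "inj_on (\<lambda>(x, y). (- (g * y), - (g * x))) (?X 1)"
      using that by (auto simp: inj_on_def)
    ultimately have "card (?X g) = card (?X 1)" by (simp only: card_image)
    then show ?thesis using X1 by (rule trans)
  qed
  have "H \<times> N = (\<Union>g \<in> UNIV - {0}. ?X g)"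
    by (auto simp: in_N_iff)
  then have "card (H \<times> N) = (\<Sum>g \<in> UNIV - {0}. card (?X g))"
    by (simp only:, intro card_UN_disjoint) auto
  also have "\<dots> = (\<Sum>g \<in> UNIV - {0::'f}. card D)"
    using Xg by (intro sum.cong) auto
  also have "\<dots> = 2 * card H * card D"
    using card_UNIV_eq by (simp add: card_Diff_singleton)
  finally have "card H * card H = card H * (2 * card D)"
    by (simp only: card_cartesian_product card_N ac_simps)
  then show ?thesis using card_H_pos by (metis mult_cancel1 not_gr0)
qed

text \<open>
  The sets \<open>D\<close> and \<open>- D\<close> cover \<open>N\<close> and together have exactly \<open>|N|\<close> elements, so they are
  disjoint.
\<close>

lemma not_both_neighbours:
  assumes "x \<in> N" shows "\<not> (x + 1 \<in> H \<and> x - 1 \<in> H)"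
proof -
  have "N \<subseteq> D \<union> uminus ` D"
  proof
    fix x assume x: "x \<in> N"
    have "x \<in> D \<or> - x \<in> D"
      using N_neighbour[OF x] neg_N[OF x] neg_closed[of "x - 1"] x
      by (auto simp: D_def)
    then show "x \<in> D \<union> uminus ` D" by (force simp: image_iff)
  qed
  then have "card N \<le> card (D \<union> uminus ` D)" by (intro card_mono) auto
  moreover have "card (D \<union> uminus ` D) + card (D \<inter> uminus ` D) = card D + card (uminus ` D)"
    by (rule card_Un_Int[symmetric]) auto
  moreover have "card (uminus ` D) = card D" by (rule card_image) simp
  ultimately have "card (D \<inter> uminus ` D) = 0"
    using twice_card_D card_N by linarith
  then have "D \<inter> uminus ` D = {}" by simp
  moreover have "x \<in> D \<inter> uminus ` D" if "x + 1 \<in> H" "x - 1 \<in> H"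
  proof -
    have "- x \<in> D" using neg_closed[OF that(2)] neg_N[OF assms] by (simp add: D_def)
    then show ?thesis using assms that by (force simp: D_def image_iff)
  qed
  ultimately show ?thesis by blast
qed

text \<open>
  Exactly one of \<open>a + 1\<close> and \<open>a - 1\<close> is in \<open>H\<close> for \<open>a\<close> in \<open>N\<close>, so their product \<open>a\<^sup>2 - 1\<close> lies
  in \<open>N\<close>. The squares of elements of \<open>N\<close> are at least \<open>|N| / 2 = |D|\<close> in number, so they are
  all the \<open>t\<close> in \<open>H\<close> with \<open>t - 1\<close> in \<open>N\<close>; and the square of an element of \<open>H\<close> is not among
  them.
\<close>

lemma square_minus_one:
  assumes p: "p \<in> H" "p\<^sup>2 \<noteq> 1"
  shows "p\<^sup>2 - 1 \<in> H"
proof -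
  let ?T = "(\<lambda>a. a\<^sup>2) ` N" and ?K = "(\<lambda>x. x + 1) ` D"
  have "?T \<subseteq> ?K"
  proof
    fix t assume "t \<in> ?T"
    then obtain a where a: "a \<in> N" "t = a\<^sup>2" by auto
    have nz: "a + 1 \<noteq> 0" "a - 1 \<noteq> 0"
      using a one neg_one by (auto simp: in_N_iff add_eq_0_iff minus_equation_iff[of a])
    have "(a + 1) * (a - 1) \<in> N"
      using not_both_neighbours[OF a(1)] N_neighbour[OF a(1)] nz N_mult_H H_mult_N
      by (auto simp: in_N_iff)
    moreover have "t \<in> H" using N_mult_N[OF a(1) a(1)] a by (simp add: power2_eq_square)
    ultimately have "t - 1 \<in> D"
      using a by (simp add: D_def power2_eq_square algebra_simps)
    then show "t \<in> ?K" by (force simp: image_iff)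
  qed
  moreover have "card ?K \<le> card ?T"
  proof -
    have "card ?K \<le> card D" by (rule card_image_le) simp
    then show ?thesis
      using card_le_twice_card_squares[of N] twice_card_D card_N by simp
  qed
  ultimately have "?T = ?K" by (intro card_seteq) auto
  moreover have "p\<^sup>2 \<notin> ?T"
    using p neg_closed[OF p(1)] by (auto simp: power2_eq_iff in_N_iff)
  ultimately have "p\<^sup>2 - 1 \<notin> D" by (force simp: image_iff)
  then show ?thesis
    using p mult_closed[OF p(1) p(1)] by (auto simp: D_def in_N_iff power2_eq_square)
qed

text \<open>
  The squares of \<open>H\<close> and \<open>0\<close> form a set \<open>C\<close> whose nonzero differences all lie in \<open>H\<close>, that is,
  a clique of the Paley graph. For \<open>g\<close> in \<open>N\<close> the map \<open>(x, y) \<mapsto> x + g y\<close> is then injective on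
  \<open>C \<times> C\<close>, so \<open>|C|\<^sup>2\<close> is at most the order of the field. With \<open>k = |D|\<close> this reads
  \<open>(k + 1)\<^sup>2 \<le> 4 k + 1\<close>, so that \<open>k \<le> 2\<close>.
\<close>

lemma card_UNIV_cases: "card (UNIV :: 'f set) = 5 \<or> card (UNIV :: 'f set) = 9"
proof -
  define C where "C = insert 0 ((\<lambda>h. h\<^sup>2) ` H)"
  have sq: "h\<^sup>2 \<in> H" if "h \<in> H" for h
    using mult_closed[OF that that] by (simp add: power2_eq_square)
  have clique: "u - v \<in> H" if uv: "u \<in> C" "v \<in> C" "u \<noteq> v" for u v
  proof (cases "u = 0 \<or> v = 0")
    case True
    then consider h where "u = 0" "v = h\<^sup>2" "h \<in> H" | h where "v = 0" "u = h\<^sup>2" "h \<in> H"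
      using uv unfolding C_def by blast
    then show ?thesis using sq neg_closed by cases simp_all
  next
    case False
    then obtain h g where hg: "h \<in> H" "g \<in> H" "u = h\<^sup>2" "v = g\<^sup>2"
      using uv by (auto simp: C_def)
    have g0: "g \<noteq> 0" using hg zero_notin by auto
    have "(h * inverse g)\<^sup>2 \<noteq> 1"
      using hg uv(3) g0 by (auto simp: power_mult_distrib field_simps)
    then have "(h * inverse g)\<^sup>2 - 1 \<in> H"
      using square_minus_one mult_closed inverse_closed hg by blast
    then have "g\<^sup>2 * ((h * inverse g)\<^sup>2 - 1) \<in> H"
      using mult_closed sq[OF hg(2)] by blast
    moreover have "g\<^sup>2 * ((h * inverse g)\<^sup>2 - 1) = u - v"
      using hg g0 by (simp add: power_mult_distrib field_simps)
    ultimately show ?thesis by simp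
  qed
  obtain g where g: "g \<in> N" using N_nonempty by blast
  have "inj_on (\<lambda>(x, y). x + g * y) (C \<times> C)"
  proof (rule inj_onI, clarify)
    fix x y x' y'
    assume C: "x \<in> C" "y \<in> C" "x' \<in> C" "y' \<in> C" and eq: "x + g * y = x' + g * y'"
    have yy: "y = y'"
    proof (rule ccontr)
      assume ne: "y \<noteq> y'"
      have "x' - x = g * (y - y')" using eq by (simp add: algebra_simps)
      moreover have "g * (y - y') \<in> N"
        using clique[OF C(2,4) ne] N_mult_H[OF g] by blast
      moreover have "x' - x \<in> insert 0 H"
        using clique[OF C(3,1)] by (cases "x' = x") auto
      ultimately show False by (simp add: N_def)
    qed
    then show "x = x' \<and> y = y'" using eq by simp
  qed
  then have "card (C \<times> C) \<le> card (UNIV :: 'f set)"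
    using card_inj_on_le[of _ "C \<times> C" UNIV] fin by blast
  moreover have "card C \<ge> card D + 1"
  proof -
    have "0 \<notin> (\<lambda>h. h\<^sup>2) ` H" using zero_notin by auto
    then have "card C = card ((\<lambda>h. h\<^sup>2) ` H) + 1" by (simp add: C_def)
    then show ?thesis
      using card_le_twice_card_squares[of H] twice_card_D by simp
  qed
  then have "(card D + 1) * (card D + 1) \<le> card C * card C" by (intro mult_le_mono)
  ultimately have "(card D + 1) * (card D + 1) \<le> 4 * card D + 1"
    using card_UNIV_eq twice_card_D by (simp add: card_cartesian_product)
  then have "card D * card D \<le> 2 * card D" by simp
  then have "card D \<le> 2" by (metis mult_le_cancel2 not_gr0 zero_le)
  moreover have "card D \<noteq> 0" using twice_card_D card_H_pos by linarith
  ultimately have "card D = 1 \<or> card D = 2" by linarith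
  then show ?thesis using card_UNIV_eq twice_card_D by auto
qed

end

text \<open>
  The nonzero \<open>q\<close>-potents form a subgroup; it contains \<open>-1\<close> because \<open>q\<close> is odd.
\<close>

lemma potent_translates_cover:
  fixes q :: nat
  assumes fin: "finite (UNIV :: 'f::field set)" and q: "q > 1" "odd q"
    and cover: "\<And>a :: 'f. a ^ q = a \<or> (a + 1) ^ q = a + 1 \<or> (a - 1) ^ q = a - 1"
    and ne: "card (UNIV :: 'f set) \<noteq> 5" "card (UNIV :: 'f set) \<noteq> 9"
  shows "(a :: 'f) ^ q = a"
proof (rule ccontr)
  assume a: "a ^ q \<noteq> a"
  define H where "H = {x :: 'f. x \<noteq> 0 \<and> x ^ q = x}"
  have H0: "x \<in> insert 0 H \<longleftrightarrow> x ^ q = x" for x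
    using q by (auto simp: H_def)
  interpret covering_subgroup H
  proof
    show "x \<in> insert 0 H \<or> x + 1 \<in> insert 0 H \<or> x - 1 \<in> insert 0 H" for x
      unfolding H0 by (rule cover)
    show "insert 0 H \<noteq> UNIV" using a H0 by blast
    show "inverse x \<in> H" if "x \<in> H" for x
      using that by (simp add: H_def power_inverse)
    show "- 1 \<in> H" using q by (simp add: H_def)
    show "x * y \<in> H" if "x \<in> H" "y \<in> H" for x y
      using that by (simp add: H_def power_mult_distrib)
  qed (simp_all add: H_def fin)
  show False using card_UNIV_cases ne by blast
qed

section \<open>Torsion modules over a polynomial ring\<close>

text \<open>
  A vector space over a field with a distinguished linear operator, the action of \<open>x\<close>, seen as
  a module over the polynomial ring. In the locale, \<open>span\<close> and \<open>subspace\<close> are the generated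
  submodule and the submodules, that is, the subspaces invariant under the operator.
\<close>

locale polynomial_module = Modules.module scale
  for scale :: "'f::field poly \<Rightarrow> 'b::ab_group_add \<Rightarrow> 'b" (infixr \<open>*s\<close> 75)
begin

text \<open>
  The step of the structure theorem for torsion modules: a cyclic summand splits off. Among
  all relations \<open>c a \<in> span T\<close> where \<open>{a} \<union> T\<close> generates the module and \<open>c \<noteq> 0\<close>, take one with
  \<open>c\<close> of least degree. Division with remainder shows that \<open>c\<close> divides the coefficients of
  \<open>c a\<close> on \<open>T\<close> (a nonzero remainder could be made the coefficient of a relation of smaller
  degree), so \<open>a\<close> can be changed modulo \<open>span T\<close> to satisfy \<open>c a = 0\<close>; and in the same way \<open>c\<close>
  divides every \<open>h\<close> with \<open>h a \<in> span T\<close>, so that the sum is direct.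
\<close>

lemma split_off_cyclic:
  assumes "finite S" "S \<noteq> {}" and torsion: "\<And>x. x \<in> S \<Longrightarrow> \<exists>c. c \<noteq> 0 \<and> c *s x = 0"
  shows "\<exists>a T c. finite T \<and> card T < card S \<and> span (insert a T) = span S \<and>
    c \<noteq> 0 \<and> c *s a = 0 \<and> (\<forall>h. h *s a \<in> span T \<longrightarrow> c dvd h)"
proof -
  define adm where "adm = (\<lambda>(a, T, c). finite T \<and> card T < card S \<and>
    span (insert a T) = span S \<and> c \<noteq> 0 \<and> c *s a \<in> span T)"
  obtain s where s: "s \<in> S" using assms by blast
  obtain c0 where "c0 \<noteq> 0" "c0 *s s = 0" using torsion[OF s] by blast
  then have "adm (s, S - {s}, c0)"
    using s \<open>finite S\<close> card_Diff1_less[OF \<open>finite S\<close> s]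
    by (simp add: adm_def span_zero insert_absorb del: card_Diff_insert)
  then obtain a T c where adm: "adm (a, T, c)"
    and least: "\<And>a' T' c'. adm (a', T', c') \<Longrightarrow> degree c \<le> degree c'"
    using ex_has_least_nat[of adm "(s, S - {s}, c0)" "\<lambda>(a, T, c). degree c"] by fastforce
  have T: "finite T" "card T < card S" "span (insert a T) = span S" "c \<noteq> 0" "c *s a \<in> span T"
    using adm by (auto simp: adm_def)
  obtain u where u: "c *s a = (\<Sum>t\<in>T. u t *s t)"
    using T(5) unfolding span_finite[OF T(1)] by auto
  have dvd_u: "c dvd u t" if t: "t \<in> T" for t
  proof (rule ccontr)
    assume ndvd: "\<not> c dvd u t"
    \<comment> \<open>Exchange the roles of \<open>a\<close> and \<open>t\<close>: the remainder becomes the coefficient of \<open>t\<close> in a relation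
      for the generators \<open>t\<close>, \<open>a'\<close> and \<open>T - {t}\<close>.\<close>
    define a' where "a' = a - (u t div c) *s t"
    define T' where "T' = insert a' (T - {t})"
    have "u t *s t = c *s a - (\<Sum>s\<in>T - {t}. u s *s s)"
      unfolding u using T(1) t by (simp add: sum.remove)
    moreover have "(u t mod c) *s t = u t *s t - (c * (u t div c)) *s t"
      by (simp add: minus_mult_div_eq_mod scale_left_diff_distrib[symmetric])
    ultimately have "(u t mod c) *s t = c *s a' - (\<Sum>s\<in>T - {t}. u s *s s)"
      by (simp add: a'_def scale_right_diff_distrib)
    moreover have "c *s a' - (\<Sum>s\<in>T - {t}. u s *s s) \<in> span T'"
      by (intro span_diff span_sum span_scale span_base) (auto simp: T'_def)
    ultimately have "(u t mod c) *s t \<in> span T'" by simp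
    moreover have "card T' \<le> card T"
    proof -
      have "card T' \<le> Suc (card (T - {t}))" unfolding T'_def by (rule card_insert_le_m1) auto
      then show ?thesis using card_Suc_Diff1[OF T(1) t] by simp
    qed
    moreover have "span (insert t T') = span S"
    proof -
      have "insert t T' = insert a' T" using t by (auto simp: T'_def)
      moreover have "a' - a \<in> span T"
        unfolding a'_def using t by (simp add: span_neg span_scale span_base)
      ultimately show ?thesis using eq_span_insert_eq T(3) by metis
    qed
    moreover have "u t mod c \<noteq> 0" using ndvd by (simp add: dvd_eq_mod_eq_0)
    ultimately have "adm (t, T', u t mod c)"
      using T(1,2) by (simp add: adm_def T'_def)
    from least[OF this] show False
      using degree_mod_less'[OF T(4) \<open>u t mod c \<noteq> 0\<close>] by simp
  qed
  define a' where "a' = a - (\<Sum>t\<in>T. (u t div c) *s t)"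
  have "a' - a \<in> span T"
  proof -
    have "(\<Sum>t\<in>T. (u t div c) *s t) \<in> span T" by (intro span_sum span_scale span_base)
    then show ?thesis by (simp add: a'_def span_neg)
  qed
  then have span': "span (insert a' T) = span S"
    using eq_span_insert_eq T(3) by metis
  have zero: "c *s a' = 0"
    unfolding a'_def scale_right_diff_distrib u scale_sum_right scale_scale
    using dvd_u by (simp add: sum_subtractf[symmetric])
  have "c dvd h" if h: "h *s a' \<in> span T" for h
  proof (rule ccontr)
    assume ndvd: "\<not> c dvd h"
    have "(h mod c) *s a' = h *s a' - (h div c) *s c *s a'"
      by (simp add: minus_div_mult_eq_mod scale_left_diff_distrib[symmetric] del: scale_zero_right)
    then have "adm (a', T, h mod c)"
      using h zero span' T(1,2) ndvd by (simp add: adm_def dvd_eq_mod_eq_0)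
    from least[OF this] show False
      using degree_mod_less'[of c h] T(4) ndvd by (auto simp: dvd_eq_mod_eq_0)
  qed
  then show ?thesis
    using T(1,2,4) span' zero by blast
qed

definition fscale :: "'f \<Rightarrow> 'b \<Rightarrow> 'b" (infixr \<open>\<cdot>\<close> 75) where
  "c \<cdot> x = [:c:] *s x"

sublocale F: vector_space fscale
  by unfold_locales
    (simp_all add: fscale_def scale_right_distrib scale_left_distrib[symmetric] one_pCons[symmetric] mult.commute)

lemma subspace_fscale: "subspace V \<Longrightarrow> x \<in> V \<Longrightarrow> c \<cdot> x \<in> V"
  by (simp add: fscale_def subspace_scale)

abbreviation shift :: "'b \<Rightarrow> 'b" where
  "shift x \<equiv> [:0, 1:] *s x"

definition linear_on :: "'b set \<Rightarrow> ('b \<Rightarrow> 'b) \<Rightarrow> bool" where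
  "linear_on V f \<longleftrightarrow> f ` V \<subseteq> V \<and> (\<forall>x\<in>V. \<forall>y\<in>V. f (x + y) = f x + f y) \<and>
     (\<forall>c. \<forall>x\<in>V. f (c \<cdot> x) = c \<cdot> f x)"

lemma linear_on_closed: "linear_on V f \<Longrightarrow> x \<in> V \<Longrightarrow> f x \<in> V"
  and linear_on_add: "linear_on V f \<Longrightarrow> x \<in> V \<Longrightarrow> y \<in> V \<Longrightarrow> f (x + y) = f x + f y"
  and linear_on_scale: "linear_on V f \<Longrightarrow> x \<in> V \<Longrightarrow> f (c \<cdot> x) = c \<cdot> f x"
  by (auto simp: linear_on_def)

lemma linear_on_zero: "linear_on V f \<Longrightarrow> subspace V \<Longrightarrow> f 0 = 0"
  using linear_on_scale[of V f 0 0] by (simp add: subspace_0)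

lemma linear_on_minus: "linear_on V f \<Longrightarrow> x \<in> V \<Longrightarrow> f (- x) = - f x"
  using linear_on_scale[of V f x "-1"] by simp

lemma linear_on_diff:
  "linear_on V f \<Longrightarrow> subspace V \<Longrightarrow> x \<in> V \<Longrightarrow> y \<in> V \<Longrightarrow> f (x - y) = f x - f y"
  using linear_on_add[of V f x "- y"] by (simp add: linear_on_minus subspace_neg)

lemma linear_on_sum:
  assumes "linear_on V f" "subspace V" "\<And>i. i \<in> I \<Longrightarrow> g i \<in> V"
  shows "f (\<Sum>i\<in>I. g i) = (\<Sum>i\<in>I. f (g i))"
  using assms(3)
  by (induction I rule: infinite_finite_induct)
    (simp_all add: linear_on_zero[OF assms(1,2)] linear_on_add[OF assms(1)] subspace_sum[OF assms(2)])

lemma linear_on_compose: "linear_on V f \<Longrightarrow> linear_on V g \<Longrightarrow> linear_on V (\<lambda>x. f (g x))"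
  unfolding linear_on_def by (auto simp: image_subset_iff)

lemma linear_on_funpow: "linear_on V f \<Longrightarrow> linear_on V (f ^^ k)"
  by (induction k) (auto simp: linear_on_def image_subset_iff)

lemma linear_on_sub:
  "subspace V \<Longrightarrow> linear_on V f \<Longrightarrow> linear_on V g \<Longrightarrow> linear_on V (\<lambda>x. f x - g x)"
  by (auto simp: linear_on_def image_subset_iff subspace_diff algebra_simps)

lemma linear_on_shift: "subspace V \<Longrightarrow> linear_on V shift"
  by (auto simp: linear_on_def fscale_def subspace_scale scale_right_distrib mult.commute)

text \<open>
  The operator \<open>x\<close> of an invariant subspace is a sum of operators \<open>f\<close> and \<open>g\<close>, with conditions
  imposed on the sequences of iterates \<open>f\<^sup>k v\<close> and \<open>g\<^sup>k v\<close>. Being idempotent, \<open>q\<close>-potent or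
  nilpotent of fixed index is such a condition (for instance \<open>s 2 = s 1\<close>), and conditions that
  survive the addition of sequences pass to direct sums.
\<close>

definition decomposable :: "((nat \<Rightarrow> 'b) \<Rightarrow> bool) \<Rightarrow> ((nat \<Rightarrow> 'b) \<Rightarrow> bool) \<Rightarrow> 'b set \<Rightarrow> bool" where
  "decomposable P Q V \<longleftrightarrow> (\<exists>f g. linear_on V f \<and> linear_on V g \<and>
     (\<forall>x\<in>V. f x + g x = shift x \<and> P (\<lambda>k. (f ^^ k) x) \<and> Q (\<lambda>k. (g ^^ k) x)))"

text \<open>
  The operator acting as \<open>f\<close> and \<open>g\<close> on the two summands, obtained from the projection \<open>p\<close> to
  \<open>U\<close> along \<open>W\<close>.
\<close>

lemma linear_on_direct_sum:
  assumes sub: "subspace U" "subspace W" and disj: "U \<inter> W = {0}"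
    and f: "linear_on U f" and g: "linear_on W g"
  shows "\<exists>h. linear_on {u + w |u w. u \<in> U \<and> w \<in> W} h \<and>
    (\<forall>u\<in>U. \<forall>w\<in>W. \<forall>k. (h ^^ k) (u + w) = (f ^^ k) u + (g ^^ k) w)"
proof -
  define p where "p x = (THE u. u \<in> U \<and> x - u \<in> W)" for x
  have p: "p (u + w) = u" if "u \<in> U" "w \<in> W" for u w
    unfolding p_def
  proof (rule the_equality)
    fix u' assume u': "u' \<in> U \<and> u + w - u' \<in> W"
    then have "u + w - u' - w \<in> W" using that sub by (blast intro: subspace_diff)
    moreover have "u + w - u' - w = u - u'" by simp
    ultimately have "u - u' \<in> U \<inter> W" using u' that sub subspace_diff by auto
    then show "u' = u" using disj by simp
  qed (use that in simp)
  define h where "h x = f (p x) + g (x - p x)" for x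
  have h: "h (u + w) = f u + g w" if "u \<in> U" "w \<in> W" for u w
    using p[OF that] by (simp add: h_def)
  have pow: "(h ^^ k) (u + w) = (f ^^ k) u + (g ^^ k) w" if "u \<in> U" "w \<in> W" for u w k
    by (induction k)
      (simp_all add: h that linear_on_closed[OF linear_on_funpow[OF f]]
        linear_on_closed[OF linear_on_funpow[OF g]])
  have "linear_on {u + w |u w. u \<in> U \<and> w \<in> W} h"
    unfolding linear_on_def
  proof (intro conjI allI ballI)
    show "h ` {u + w |u w. u \<in> U \<and> w \<in> W} \<subseteq> {u + w |u w. u \<in> U \<and> w \<in> W}"
      using h linear_on_closed[OF f] linear_on_closed[OF g] by fastforce
  next
    fix x y assume "x \<in> {u + w |u w. u \<in> U \<and> w \<in> W}" "y \<in> {u + w |u w. u \<in> U \<and> w \<in> W}"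
    then obtain u w u' w' where *: "u \<in> U" "w \<in> W" "x = u + w" "u' \<in> U" "w' \<in> W" "y = u' + w'"
      by auto
    have "x + y = (u + u') + (w + w')" using * by simp
    then have "h (x + y) = f (u + u') + g (w + w')"
      using * sub by (simp only: h subspace_add)
    then show "h (x + y) = h x + h y"
      using * by (simp add: h linear_on_add[OF f] linear_on_add[OF g])
  next
    fix c x assume "x \<in> {u + w |u w. u \<in> U \<and> w \<in> W}"
    then obtain u w where *: "u \<in> U" "w \<in> W" "x = u + w" by auto
    have "c \<cdot> x = c \<cdot> u + c \<cdot> w" using * by (simp add: F.scale_right_distrib)
    then have "h (c \<cdot> x) = f (c \<cdot> u) + g (c \<cdot> w)"
      using * sub by (simp only: h subspace_fscale)
    then show "h (c \<cdot> x) = c \<cdot> h x"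
      using * by (simp add: h linear_on_scale[OF f] linear_on_scale[OF g] F.scale_right_distrib)
  qed
  then show ?thesis using pow by blast
qed

lemma decomposable_direct_sum:
  assumes sub: "subspace U" "subspace W" and disj: "U \<inter> W = {0}"
    and add: "\<And>s s'. P s \<Longrightarrow> P s' \<Longrightarrow> P (\<lambda>k. s k + s' k)"
      "\<And>s s'. Q s \<Longrightarrow> Q s' \<Longrightarrow> Q (\<lambda>k. s k + s' k)"
    and U: "decomposable P Q U" and W: "decomposable P Q W"
  shows "decomposable P Q {u + w |u w. u \<in> U \<and> w \<in> W}"
proof -
  obtain f g where fg: "linear_on U f" "linear_on U g"
    "\<And>x. x \<in> U \<Longrightarrow> f x + g x = shift x \<and> P (\<lambda>k. (f ^^ k) x) \<and> Q (\<lambda>k. (g ^^ k) x)"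
    using U unfolding decomposable_def by blast
  obtain f' g' where fg': "linear_on W f'" "linear_on W g'"
    "\<And>x. x \<in> W \<Longrightarrow> f' x + g' x = shift x \<and> P (\<lambda>k. (f' ^^ k) x) \<and> Q (\<lambda>k. (g' ^^ k) x)"
    using W unfolding decomposable_def by blast
  obtain F where F: "linear_on {u + w |u w. u \<in> U \<and> w \<in> W} F"
    "\<And>u w k. u \<in> U \<Longrightarrow> w \<in> W \<Longrightarrow> (F ^^ k) (u + w) = (f ^^ k) u + (f' ^^ k) w"
    using linear_on_direct_sum[OF sub disj fg(1) fg'(1)] by blast
  obtain G where G: "linear_on {u + w |u w. u \<in> U \<and> w \<in> W} G"
    "\<And>u w k. u \<in> U \<Longrightarrow> w \<in> W \<Longrightarrow> (G ^^ k) (u + w) = (g ^^ k) u + (g' ^^ k) w"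
    using linear_on_direct_sum[OF sub disj fg(2) fg'(2)] by blast
  have "F x + G x = shift x \<and> P (\<lambda>k. (F ^^ k) x) \<and> Q (\<lambda>k. (G ^^ k) x)"
    if x: "x \<in> {u + w |u w. u \<in> U \<and> w \<in> W}" for x
  proof -
    obtain u w where uw: "u \<in> U" "w \<in> W" "x = u + w" using x by auto
    have "F x = f u + f' w" "G x = g u + g' w"
      using F(2)[OF uw(1,2), of 1] G(2)[OF uw(1,2), of 1] uw by simp_all
    then have "F x + G x = (f u + g u) + (f' w + g' w)" by simp
    also have "\<dots> = shift x"
      using fg(3)[OF uw(1)] fg'(3)[OF uw(2)] uw by (simp add: scale_right_distrib)
    finally show ?thesis
      using F(2)[OF uw(1,2)] G(2)[OF uw(1,2)] add fg(3)[OF uw(1)] fg'(3)[OF uw(2)] uw by simp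
  qed
  then show ?thesis unfolding decomposable_def using F(1) G(1) by blast
qed

lemma decomposable_zero:
  assumes "P (\<lambda>_. 0)" "Q (\<lambda>_. 0)"
  shows "decomposable P Q {0}"
proof -
  have "((\<lambda>_ :: 'b. 0 :: 'b) ^^ k) 0 = 0" for k by (induction k) auto
  then show ?thesis
    unfolding decomposable_def using assms
    by (intro exI[of _ "\<lambda>_. 0"]) (auto simp: linear_on_def)
qed

text \<open>
  Induction on the number of generators, splitting off one cyclic submodule at a time.
\<close>

lemma decomposable_if_cyclic:
  assumes "finite S" and torsion: "\<And>x. x \<in> span S \<Longrightarrow> \<exists>c. c \<noteq> 0 \<and> c *s x = 0"
    and zero: "P (\<lambda>_. 0)" "Q (\<lambda>_. 0)"
    and add: "\<And>s s'. P s \<Longrightarrow> P s' \<Longrightarrow> P (\<lambda>k. s k + s' k)"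
      "\<And>s s'. Q s \<Longrightarrow> Q s' \<Longrightarrow> Q (\<lambda>k. s k + s' k)"
    and cyclic: "\<And>a c. c \<noteq> 0 \<Longrightarrow> (\<And>h. h *s a = 0 \<longleftrightarrow> c dvd h) \<Longrightarrow> decomposable P Q (span {a})"
  shows "decomposable P Q (span S)"
  using assms(1,2)
proof (induction "card S" arbitrary: S rule: less_induct)
  case less
  show ?case
  proof (cases "S = {}")
    case True
    then show ?thesis using decomposable_zero[of P Q] zero by simp
  next
    case False
    obtain a T c where T: "finite T" "card T < card S" "span (insert a T) = span S"
      "c \<noteq> 0" "c *s a = 0" "\<And>h. h *s a \<in> span T \<Longrightarrow> c dvd h"
      using split_off_cyclic[OF less.prems(1) False less.prems(2)[OF span_base]] by blast
    have ann: "h *s a = 0 \<longleftrightarrow> c dvd h" for h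
    proof
      show "h *s a = 0 \<Longrightarrow> c dvd h" using T(6)[of h] span_zero by simp
      show "c dvd h \<Longrightarrow> h *s a = 0"
        using T(5) by (metis dvdE mult.commute scale_scale scale_zero_right)
    qed
    have "span T \<subseteq> span S" using T(3) span_mono[of T "insert a T"] by auto
    then have "decomposable P Q (span T)"
      using less.hyps[OF T(2,1)] less.prems(2) by blast
    moreover have "decomposable P Q (span {a})"
      using cyclic T(4) ann by blast
    moreover have "span {a} \<inter> span T = {0}"
      using T(6) ann span_zero by (auto simp: span_singleton)
    ultimately have "decomposable P Q {u + w |u w. u \<in> span {a} \<and> w \<in> span T}"
      by (intro decomposable_direct_sum add) auto
    then show ?thesis
      using span_Un[of "{a}" T] T(3) by simp
  qed
qed

end

section \<open>Decomposing companion matrices\<close>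

context polynomial_module
begin

text \<open>
  The vectors on which \<open>f\<close> behaves like a \<open>q\<close>-potent. They form a subspace, so an operator is
  \<open>q\<close>-potent as soon as this subspace contains a basis.
\<close>

definition potents :: "nat \<Rightarrow> 'b set \<Rightarrow> ('b \<Rightarrow> 'b) \<Rightarrow> 'b set" where
  "potents q V f = {x \<in> V. (f ^^ q) x = f x}"

lemma potents_add:
  assumes "linear_on V f" "subspace V" "x \<in> potents q V f" "y \<in> potents q V f"
  shows "x + y \<in> potents q V f"
  using assms
  by (simp add: potents_def linear_on_add[OF assms(1)] linear_on_add[OF linear_on_funpow[OF assms(1)]]
      subspace_add)

lemma potents_scale:
  assumes "linear_on V f" "subspace V" "x \<in> potents q V f"
  shows "a \<cdot> x \<in> potents q V f"
  using assms
  by (simp add: potents_def linear_on_scale[OF assms(1)] linear_on_scale[OF linear_on_funpow[OF assms(1)]]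
      subspace_fscale)

lemma potents_diff:
  assumes "linear_on V f" "subspace V" "x \<in> potents q V f" "y \<in> potents q V f"
  shows "x - y \<in> potents q V f"
  using potents_add[OF assms(1-3) potents_scale[OF assms(1,2,4), of "-1"]] by simp

lemma eigenvector_potent:
  assumes "linear_on V f" "x \<in> V" "f x = a \<cdot> x" "a ^ q = a"
  shows "x \<in> potents q V f"
proof -
  have "(f ^^ k) x = a ^ k \<cdot> x" for k
    by (induction k) (simp_all add: linear_on_scale[OF assms(1,2)] assms(3) mult.commute)
  then show ?thesis using assms by (simp add: potents_def)
qed

lemma kernel_potent:
  assumes "linear_on V f" "x \<in> V" "f x = 0" "q > 0"
  shows "x \<in> potents q V f"
  using eigenvector_potent[OF assms(1,2), of 0 q] assms by simp

lemma involution_potent: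
  assumes "x \<in> V" "f (f x) = x" "odd q"
  shows "x \<in> potents q V f"
proof -
  have "(f ^^ (2 * k)) x = x" for k
    by (induction k) (simp_all add: assms(2))
  then have "(f ^^ (2 * k + 1)) x = f x" for k by simp
  then show ?thesis using assms by (auto simp: potents_def elim!: oddE)
qed

lemma neg_eq_self:
  assumes "(2 :: 'f) = 0"
  shows "- x = (x :: 'b)"
proof -
  have "x + x = 2 \<cdot> x" using F.scale_left_distrib[of 1 1 x] by simp
  then show ?thesis using assms by (simp add: neg_eq_iff_add_eq_0)
qed

text \<open>
  In characteristic 2 with \<open>q\<close> odd, \<open>1\<close> is a multiple root of \<open>X\<^sup>q - X\<close>, so that Jordan blocks
  of size 2 with eigenvalue \<open>1\<close> are \<open>q\<close>-potent. Explicitly, \<open>f\<^sup>q x = x + q z = x + z\<close>.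
\<close>

lemma jordan_pair_potent:
  assumes "linear_on V f" "x \<in> V" "z \<in> V" "f x = x + z" "f z = z" "odd q" "(2 :: 'f) = 0"
    and "subspace V"
  shows "x \<in> potents q V f"
proof -
  have "(f ^^ k) x = x + of_nat k \<cdot> z" for k
  proof (induction k)
    case (Suc k)
    then show ?case
      using assms by (simp add: linear_on_add[OF assms(1)] linear_on_scale[OF assms(1)]
          subspace_fscale F.scale_left_distrib)
  qed simp
  moreover have "(of_nat q :: 'f) = 1"
    using assms(6,7) by (auto elim!: oddE)
  ultimately show ?thesis using assms by (simp add: potents_def)
qed

end

text \<open>
  The module \<open>span {v}\<close> is isomorphic to the quotient of the polynomial ring by \<open>c\<close>; on its
  basis \<open>e i = x\<^sup>i v\<close>, \<open>i < degree c\<close>, the operator \<open>x\<close> acts by a companion matrix.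
\<close>

locale cyclic_module = polynomial_module scale
  for scale :: "'f::field poly \<Rightarrow> 'b::ab_group_add \<Rightarrow> 'b" (infixr \<open>*s\<close> 75) +
  fixes v :: 'b and c :: "'f poly"
  assumes c_nonzero: "c \<noteq> 0"
    and annihilator: "h *s v = 0 \<longleftrightarrow> c dvd h"
begin

abbreviation "U \<equiv> span {v}"

definition "e i = monom 1 i *s v"

definition "coord i x = coeff ((SOME f. f *s v = x) mod c) i"

lemma subspace_U: "subspace U" by simp

lemma in_U_iff: "x \<in> U \<longleftrightarrow> (\<exists>f. x = f *s v)"
  by (auto simp: span_singleton)

lemma e_in_U [simp]: "e i \<in> U"
  by (auto simp: e_def in_U_iff)

lemma shift_e: "shift (e i) = e (Suc i)"
  by (simp add: e_def monom_Suc)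

lemma coord_scale: "coord i (f *s v) = coeff (f mod c) i"
proof -
  define g where "g = (SOME g. g *s v = f *s v)"
  have "g *s v = f *s v" unfolding g_def by (rule someI[of _ f]) simp
  then have "(g - f) *s v = 0" by (simp add: scale_left_diff_distrib)
  then have "g mod c = f mod c" by (simp add: annihilator mod_eq_dvd_iff)
  then show ?thesis by (simp add: coord_def g_def)
qed

lemma coord_add: "x \<in> U \<Longrightarrow> y \<in> U \<Longrightarrow> coord i (x + y) = coord i x + coord i y"
  by (auto simp: in_U_iff scale_left_distrib[symmetric] coord_scale poly_mod_add_left)

lemma coord_fscale: "x \<in> U \<Longrightarrow> coord i (a \<cdot> x) = a * coord i x"
  by (auto simp: in_U_iff fscale_def coord_scale mod_smult_left)

lemma coord_e: "j < degree c \<Longrightarrow> coord i (e j) = (if i = j then 1 else 0)"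
  by (simp add: e_def coord_scale mod_poly_less degree_monom_eq)

lemma expand:
  assumes "x \<in> U"
  shows "x = (\<Sum>i<degree c. coord i x \<cdot> e i)"
proof -
  obtain f where f: "x = f *s v" using assms by (auto simp: in_U_iff)
  define p where "p = f mod c"
  have "(f - p) *s v = 0" by (simp add: annihilator p_def dvd_minus_mod)
  then have x: "x = p *s v" by (simp add: f scale_left_diff_distrib)
  have "p = (\<Sum>i<degree c. monom (coeff p i) i)"
  proof (cases "p = 0")
    case False
    then have deg: "degree p < degree c"
      using degree_mod_less[OF c_nonzero, of f] by (simp add: p_def)
    then obtain m where m: "degree c = Suc m" by (cases "degree c") auto
    then show ?thesis
      using poly_as_sum_of_monoms'[of p m] deg by (simp add: lessThan_Suc_atMost)
  qed simp
  then have "x = (\<Sum>i<degree c. monom (coeff p i) i) *s v" using x by simp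
  also have "\<dots> = (\<Sum>i<degree c. coord i x \<cdot> e i)"
    by (simp add: scale_sum_left fscale_def e_def f coord_scale p_def smult_monom)
  finally show ?thesis .
qed

definition extension :: "(nat \<Rightarrow> 'b) \<Rightarrow> 'b \<Rightarrow> 'b" where
  "extension w x = (\<Sum>i<degree c. coord i x \<cdot> w i)"

lemma linear_on_extension:
  assumes "\<And>i. i < degree c \<Longrightarrow> w i \<in> U"
  shows "linear_on U (extension w)"
  unfolding linear_on_def extension_def
  by (auto simp: coord_add coord_fscale F.scale_left_distrib sum.distrib F.scale_sum_right
      intro!: subspace_sum subspace_fscale assms)

lemma extension_e:
  assumes "i < degree c"
  shows "extension w (e i) = w i"
proof -
  have "extension w (e i) = (\<Sum>j<degree c. if j = i then w i else 0)"
    unfolding extension_def using assms by (intro sum.cong) (auto simp: coord_e)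
  then show ?thesis using assms by simp
qed

lemma linear_on_eqI:
  assumes f: "linear_on U f" and g: "linear_on U g"
    and eq: "\<And>i. i < degree c \<Longrightarrow> f (e i) = g (e i)" and x: "x \<in> U"
  shows "f x = g x"
proof -
  have *: "h x = (\<Sum>i<degree c. coord i x \<cdot> h (e i))" if h: "linear_on U h" for h
  proof -
    have "h x = h (\<Sum>i<degree c. coord i x \<cdot> e i)" using expand[OF x] by simp
    also have "\<dots> = (\<Sum>i<degree c. h (coord i x \<cdot> e i))"
      by (rule linear_on_sum[OF h]) (auto intro: subspace_fscale)
    finally show ?thesis by (simp add: linear_on_scale[OF h])
  qed
  show ?thesis using *[OF f] *[OF g] eq by simp
qed

lemma potents_all:
  assumes f: "linear_on U f" and e: "\<And>i. i < degree c \<Longrightarrow> e i \<in> potents q U f" and x: "x \<in> U"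
  shows "(f ^^ q) x = f x"
  using linear_on_eqI[OF linear_on_funpow[OF f, of q] f _ x] e by (auto simp: potents_def)

lemma span_trivial:
  assumes "degree c = 0"
  shows "U = {0}"
  using expand subspace_0[OF subspace_U] assms by auto

text \<open>
  Cut the basis, from its end, into consecutive pairs, with \<open>e 0\<close> left over if their number is
  odd. The operator \<open>B\<close> interchanges the members of each pair and kills a left-over \<open>e 0\<close>;
  only the last pair carries the trace \<open>t\<close>, and there \<open>B\<close> maps \<open>e m\<close> to \<open>t e m\<close> if \<open>t \<noteq> 0\<close>.
  Thus \<open>B\<close> is a direct sum of involutions, zero operators and diagonalisable blocks with
  eigenvalues \<open>0\<close> and \<open>t\<close>. What is left, \<open>N = x - B\<close>, kills the first members of the pairs,
  maps the second members other than \<open>e m\<close> to combinations of first members, and maps \<open>e m\<close> to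
  a combination of earlier basis vectors; so \<open>N\<^sup>3 = 0\<close>. With \<open>m\<close> the last index, the first
  members have \<open>m - i\<close> odd; if \<open>m = 0\<close>, then \<open>B\<close> is multiplication by \<open>t\<close>.
\<close>

lemma nilpotent_plus_potent:
  assumes q: "odd q" and field: "\<And>a :: 'f. a ^ q = a"
  shows "decomposable (\<lambda>s. s 3 = 0) (\<lambda>s. s q = s 1) U"
proof (cases "degree c")
  case 0
  then show ?thesis using span_trivial decomposable_zero by simp
next
  case (Suc m)
  have q0: "q > 0" using q by (cases q) auto
  define t where "t = coord m (e (Suc m))"
  define b where "b i = (if i = m then t \<cdot> e m + (if t = 0 \<and> m > 0 then e (m - 1) else 0)
    else if odd (m - i) then e (Suc i) else if i = 0 then 0 else e (i - 1))" for i
  define B where "B = extension b"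
  define N where "N x = shift x - B x" for x
  have bU: "b i \<in> U" for i
    unfolding b_def by (auto intro!: subspace_add[OF subspace_U] subspace_fscale subspace_0)
  have B: "linear_on U B" unfolding B_def by (rule linear_on_extension) (rule bU)
  have N: "linear_on U N" unfolding N_def by (intro linear_on_sub linear_on_shift B subspace_U)
  have Be: "B (e i) = b i" if "i \<le> m" for i
    using that by (simp add: B_def extension_e Suc)
  have Ne: "N (e i) = e (Suc i) - b i" if "i \<le> m" for i
    using that by (simp add: N_def Be shift_e)
  have Nfirst: "N (e i) = 0" if "i \<le> m" "odd (m - i)" for i
    using that by (auto simp: Ne b_def)
  have Nsecond: "N (N (e i)) = 0" if i: "i < m" for i
  proof (cases "odd (m - i)")
    case True
    then show ?thesis using Nfirst[of i] i linear_on_zero[OF N subspace_U] by simp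
  next
    case False
    then have "Suc i \<noteq> m" using i by auto
    then have "N (e (Suc i)) = 0" "i > 0 \<Longrightarrow> N (e (i - 1)) = 0"
      using i False Nfirst[of "Suc i"] Nfirst[of "i - 1"] by auto
    then show ?thesis
      using i False linear_on_zero[OF N subspace_U]
      by (auto simp: Ne b_def linear_on_diff[OF N])
  qed
  have Nlast: "N (N (N (e m))) = 0"
  proof -
    have "e (Suc m) = (\<Sum>i<m. coord i (e (Suc m)) \<cdot> e i) + t \<cdot> e m"
      using expand[of "e (Suc m)"] by (simp add: Suc t_def)
    then have Nem: "N (e m) = (\<Sum>i<m. coord i (e (Suc m)) \<cdot> e i) - (if t = 0 \<and> m > 0 then e (m - 1) else 0)"
      by (simp add: Ne b_def algebra_simps)
    have NN: "linear_on U (\<lambda>x. N (N x))" by (rule linear_on_compose[OF N N])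
    have sum: "(\<Sum>i<m. coord i (e (Suc m)) \<cdot> e i) \<in> U"
      by (intro subspace_sum subspace_fscale) auto
    have "N (N (\<Sum>i<m. coord i (e (Suc m)) \<cdot> e i)) = 0"
      using Nsecond
      by (subst linear_on_sum[OF NN]) (auto intro: subspace_fscale simp: linear_on_scale[OF NN])
    then show ?thesis
      unfolding Nem using Nsecond[of "m - 1"] linear_on_zero[OF NN]
      by (auto simp: linear_on_diff[OF NN _ sum])
  qed
  have "N (N (N x)) = 0" if "x \<in> U" for x
  proof (rule linear_on_eqI[OF _ _ _ that])
    show "linear_on U (\<lambda>x. N (N (N x)))" 
      by (rule linear_on_compose[OF N linear_on_compose[OF N N]])
    show "linear_on U (\<lambda>_. 0)" by (auto simp: linear_on_def subspace_0)
    show "N (N (N (e i))) = 0" if "i < degree c" for i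
      using that Nlast Nsecond[of i] linear_on_zero[OF N] by (cases "i = m") (auto simp: Suc)
  qed
  moreover have "(B ^^ q) x = B x" if "x \<in> U" for x
  proof (rule potents_all[OF B _ that])
    fix i assume "i < degree c"
    then have i: "i \<le> m" by (simp add: Suc)
    have last_eigen: "e m \<in> potents q U B" if "t \<noteq> 0 \<or> m = 0"
      using that by (intro eigenvector_potent[OF B, of _ t] field) (auto simp: Be b_def)
    consider "i = m" | "i = m - 1" "m > 0" | "i = 0" "m > 0" "even m"
      | "Suc i < m" "odd (m - i)" | "0 < i" "i < m" "even (m - i)" using i by force
    then show "e i \<in> potents q U B"
    proof cases
      case 1
      show ?thesis
      proof (cases "t \<noteq> 0 \<or> m = 0")
        case True
        then show ?thesis using last_eigen 1 by simp
      next
        case False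
        then have "B (B (e m)) = e m" by (auto simp: Be b_def)
        then show ?thesis using involution_potent[of "e m" U B q] q 1 by simp
      qed
    next
      case 2
      then have Bi: "B (e i) = e m" by (auto simp: Be b_def)
      show ?thesis
      proof (cases "t = 0")
        case True
        then have "B (B (e i)) = e i" using 2 Bi by (auto simp: Be b_def)
        then show ?thesis using involution_potent[of "e i" U B q] q by simp
      next
        case False
        have "B (e i - inverse t \<cdot> e m) = B (e i) - inverse t \<cdot> B (e m)"
          by (simp add: linear_on_diff[OF B] linear_on_scale[OF B] subspace_fscale)
        also have "\<dots> = 0" using False by (simp add: Bi) (simp add: Be b_def)
        finally have "e i - inverse t \<cdot> e m \<in> potents q U B"
          using q0 by (intro kernel_potent[OF B] subspace_diff subspace_fscale) auto
        then have "(e i - inverse t \<cdot> e m) + inverse t \<cdot> e m \<in> potents q U B"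
          using False by (intro potents_add[OF B] potents_scale[OF B] last_eigen) auto
        then show ?thesis by simp
      qed
    next
      case 3
      then show ?thesis using q0 by (intro kernel_potent[OF B]) (auto simp: Be b_def)
    next
      case 4
      then have "B (B (e i)) = e i" by (auto simp: Be b_def)
      then show ?thesis using involution_potent[of "e i" U B q] q by simp
    next
      case 5
      then have "B (B (e i)) = e i" by (auto simp: Be b_def)
      then show ?thesis using involution_potent[of "e i" U B q] q by simp
    qed
  qed
  moreover have "N x + B x = shift x" for x by (simp add: N_def)
  ultimately show ?thesis
    unfolding decomposable_def using N B
    by (intro exI[of _ N] exI[of _ B]) (auto simp: numeral_3_eq_3)
qed

text \<open>
  The idempotent \<open>E\<close> has the shape of a block matrix with rows \<open>(0, X)\<close> and \<open>(0, 1)\<close>: it kills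
  every other basis vector and maps each of the others to itself plus its successor, which is
  killed. Then \<open>B = x - E\<close> multiplies the vectors of the second kind by \<open>-1\<close> and still shifts
  those of the first. Here the last vector \<open>e m\<close> is among the killed ones, so \<open>B\<close> has on it
  the eigenvalue \<open>t\<close> modulo the span of the rest, where \<open>B\<close> is diagonalisable with eigenvalues
  \<open>0\<close> and \<open>-1\<close>. This is harmless if there is no other vector, if \<open>t\<close> differs from both, and
  for \<open>t = -1\<close> in characteristic 2, where the eigenvalue \<open>-1 = 1\<close> may have Jordan blocks of
  size 2.
\<close>

lemma idempotent_plus_potent_last_in_kernel:
  assumes q: "odd q" and field: "\<And>a :: 'f. a ^ q = a"
    and deg: "degree c = Suc m" and t: "t = coord m (e (Suc m))"
    and cond: "m = 0 \<or> t \<noteq> 0 \<and> (t \<noteq> -1 \<or> (2 :: 'f) = 0)"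
  shows "decomposable (\<lambda>s. s 2 = s 1) (\<lambda>s. s q = s 1) U"
proof -
  have q0: "q > 0" using q by (cases q) auto
  define w where "w i = (if odd (m - i) then e i + e (Suc i) else 0)" for i
  define E where "E = extension w"
  define B where "B x = shift x - E x" for x
  have E: "linear_on U E"
    unfolding E_def by (rule linear_on_extension) (auto simp: w_def subspace_add subspace_0)
  have B: "linear_on U B" unfolding B_def by (intro linear_on_sub linear_on_shift E subspace_U)
  have Ee: "E (e i) = w i" if "i \<le> m" for i
    using that by (simp add: E_def extension_e deg)
  have Be: "B (e i) = (if odd (m - i) then - e i else e (Suc i))" if "i \<le> m" for i
    using that by (simp add: B_def Ee w_def shift_e)
  have "E (E x) = E x" if "x \<in> U" for x
  proof (rule linear_on_eqI[OF linear_on_compose[OF E E] E _ that])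
    fix i assume "i < degree c"
    then have "i \<le> m" by (simp add: deg)
    then show "E (E (e i)) = E (e i)"
      by (cases "odd (m - i)"; cases "i = m")
        (auto simp: Ee w_def linear_on_add[OF E] linear_on_zero[OF E])
  qed
  moreover have "(B ^^ q) x = B x" if "x \<in> U" for x
  proof (rule potents_all[OF B _ that])
    fix i assume "i < degree c"
    then consider "i < m" "odd (m - i)" | "i < m" "even (m - i)" | "i = m"
      by (force simp: deg)
    then show "e i \<in> potents q U B"
    proof cases
      case 1
      then show ?thesis by (intro eigenvector_potent[OF B, of _ "-1"] field) (auto simp: Be)
    next
      case 2
      then have "Suc i \<le> m" "odd (m - Suc i)" by auto
      then have "e (Suc i) \<in> potents q U B"
        by (intro eigenvector_potent[OF B, of _ "-1"] field) (auto simp: Be)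
      moreover have "e i + e (Suc i) \<in> potents q U B"
        using 2 \<open>odd (m - Suc i)\<close> \<open>Suc i \<le> m\<close> q0
        by (intro kernel_potent[OF B]) (auto simp: Be linear_on_add[OF B] subspace_add)
      ultimately have "e i + e (Suc i) - e (Suc i) \<in> potents q U B"
        by (intro potents_diff[OF B]) auto
      then show ?thesis by simp
    next
      case 3
      define z where "z = (\<Sum>i<m. coord i (e (Suc m)) \<cdot> e i)"
      have z: "z \<in> U" unfolding z_def by (intro subspace_sum subspace_fscale) auto
      have Bz: "B z \<in> U" using z linear_on_closed[OF B] by simp
      have Bem: "B (e m) = t \<cdot> e m + z"
        using expand[of "e (Suc m)"] by (simp add: Be deg t z_def add.commute)
      have BB: "B (B (e i)) = - B (e i)" if "i < m" for i
        using that by (cases "odd (m - i)") (auto simp: Be linear_on_minus[OF B])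
      have BBz: "B (B z) = - B z"
      proof -
        have "B (B z) = (\<Sum>i<m. coord i (e (Suc m)) \<cdot> B (B (e i)))"
          unfolding z_def
          by (subst linear_on_sum[OF linear_on_compose[OF B B]])
            (auto simp: linear_on_scale[OF linear_on_compose[OF B B]] subspace_fscale)
        also have "\<dots> = - (\<Sum>i<m. coord i (e (Suc m)) \<cdot> B (e i))"
          by (simp add: BB sum_negf)
        also have "(\<Sum>i<m. coord i (e (Suc m)) \<cdot> B (e i)) = B z"
          unfolding z_def
          by (subst linear_on_sum[OF B]) (auto simp: linear_on_scale[OF B] subspace_fscale)
        finally show ?thesis .
      qed
      show ?thesis
      proof (cases "m = 0")
        case True
        then show ?thesis using 3 Bem
          by (intro eigenvector_potent[OF B, of _ t] field) (auto simp: z_def)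
      next
        case False
        then have t0: "t \<noteq> 0" and t1: "t \<noteq> -1 \<or> (2 :: 'f) = 0" using cond by auto
        \<comment> \<open>The components of \<open>z\<close> for the eigenvalues \<open>0\<close> and \<open>-1\<close> of \<open>B\<close>.\<close>
        define z0 where "z0 = z + B z"
        define z1 where "z1 = - B z"
        have z01: "z0 \<in> U" "z1 \<in> U" "z = z0 + z1"
          using z Bz by (auto simp: z0_def z1_def subspace_add subspace_neg)
        have Bz0: "B z0 = 0" and Bz1: "B z1 = - z1"
          using z Bz BBz by (simp_all add: z0_def z1_def linear_on_add[OF B] linear_on_minus[OF B])
        \<comment> \<open>Correcting \<open>e m\<close> by \<open>z0 / t\<close>, and then, unless \<open>t = -1\<close>, by \<open>z1 / (t + 1)\<close>, makes it an eigenvector for \<open>t\<close>.\<close>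
        define x where "x = e m + inverse t \<cdot> z0"
        have x: "x \<in> U" unfolding x_def using z01 by (intro subspace_add subspace_fscale) auto
        have "B x = B (e m) + inverse t \<cdot> B z0"
          unfolding x_def using z01
          by (simp add: linear_on_add[OF B] linear_on_scale[OF B] subspace_fscale)
        also have "\<dots> = t \<cdot> x + z1"
          using t0 by (simp add: Bem Bz0 x_def z01(3) F.scale_right_distrib)
        finally have Bx: "B x = t \<cdot> x + z1" .
        have "x \<in> potents q U B"
        proof (cases "t = -1")
          case True
          then have two: "(2 :: 'f) = 0" using t1 by simp
          show ?thesis
            using Bx Bz1 True neg_eq_self[OF two]
            by (intro jordan_pair_potent[OF B x z01(2) _ _ q two]) auto
        next
          case False
          then have t1': "t + 1 \<noteq> 0" by (simp add: add_eq_0_iff2)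
          define y where "y = x + inverse (t + 1) \<cdot> z1"
          have y: "y \<in> U" unfolding y_def using x z01 by (intro subspace_add subspace_fscale) auto
          have "B y = B x + inverse (t + 1) \<cdot> B z1"
            unfolding y_def using x z01
            by (simp add: linear_on_add[OF B] linear_on_scale[OF B] subspace_fscale)
          also have "\<dots> = t \<cdot> x + (1 - inverse (t + 1)) \<cdot> z1"
            by (simp add: Bx Bz1 F.scale_left_diff_distrib)
          also have "1 - inverse (t + 1) = t * inverse (t + 1)"
            using t1' by (simp add: field_simps)
          finally have "B y = t \<cdot> y" by (simp add: y_def F.scale_right_distrib)
          then have "y \<in> potents q U B" by (intro eigenvector_potent[OF B y] field)
          moreover have "z1 \<in> potents q U B"
            using Bz1 by (intro eigenvector_potent[OF B z01(2), of "-1"] field) simp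
          ultimately have "y - inverse (t + 1) \<cdot> z1 \<in> potents q U B"
            by (intro potents_diff[OF B] potents_scale[OF B]) auto
          then show ?thesis by (simp add: y_def)
        qed
        moreover have "z0 \<in> potents q U B"
          using Bz0 q0 by (intro kernel_potent[OF B z01(1)])
        ultimately have "x - inverse t \<cdot> z0 \<in> potents q U B"
          by (intro potents_diff[OF B] potents_scale[OF B]) auto
        then show ?thesis using 3 by (simp add: x_def)
      qed
    qed
  qed
  moreover have "E x + B x = shift x" for x by (simp add: B_def)
  ultimately show ?thesis
    unfolding decomposable_def using E B
    by (intro exI[of _ E] exI[of _ B]) (auto simp: numeral_2_eq_2)
qed

text \<open>
  The other parity of the alternating construction: \<open>e m\<close> is now in the image part, so that
  \<open>E\<close> may add to it any combination of the killed vectors. That freedom is used to give \<open>B\<close> on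
  the last pair, modulo the span of the rest, the characteristic polynomial \<open>(X - x) (X - y)\<close>;
  its trace \<open>x + y = t - 1\<close> is forced. The part \<open>z\<close> of \<open>e (m + 1)\<close> spanned by the earlier
  vectors of the image part cannot be absorbed, but it belongs to the eigenvalue \<open>-1\<close> of \<open>B\<close>,
  so that \<open>B\<close> is diagonalisable if \<open>x\<close>, \<open>y\<close> and \<open>-1\<close> are distinct. In characteristic 2 the
  eigenvalue \<open>y = 1 = -1\<close> is allowed because of the double root.
\<close>

lemma idempotent_plus_potent_last_in_image:
  assumes q: "odd q" and field: "\<And>a :: 'f. a ^ q = a"
    and deg: "degree c = Suc m" and m: "m > 0" and t: "t = coord m (e (Suc m))"
    and xy: "x + y = t - 1"
    and cond: "x \<noteq> -1 \<and> y \<noteq> -1 \<and> x \<noteq> y \<or> x = 0 \<and> y = 1 \<and> (2 :: 'f) = 0"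
  shows "decomposable (\<lambda>s. s 2 = s 1) (\<lambda>s. s q = s 1) U"
proof -
  have q0: "q > 0" using q by (cases q) auto
  define z where "z = (\<Sum>i<m. (if even (m - i) then coord i (e (Suc m)) else 0) \<cdot> e i)"
  define r where "r = (\<Sum>i<m. (if odd (m - i) then coord i (e (Suc m)) else 0) \<cdot> e i)"
  have zU: "z \<in> U" and rU: "r \<in> U"
    unfolding z_def r_def by (auto intro!: subspace_sum subspace_fscale)
  have esm: "e (Suc m) = z + r + t \<cdot> e m"
  proof -
    have "z + r = (\<Sum>i<m. coord i (e (Suc m)) \<cdot> e i)"
      unfolding z_def r_def by (subst sum.distrib[symmetric]) (intro sum.cong, auto)
    then show ?thesis using expand[of "e (Suc m)"] by (simp add: deg t)
  qed
  define w where "w i = (if i = m then e m + r + (x * y) \<cdot> e (m - 1)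
    else if even (m - i) then e i + e (Suc i) else 0)" for i
  define E where "E = extension w"
  define B where "B x = shift x - E x" for x
  have E: "linear_on U E"
    unfolding E_def using rU
    by (intro linear_on_extension) (auto simp: w_def subspace_add subspace_0 subspace_fscale)
  have B: "linear_on U B" unfolding B_def by (intro linear_on_sub linear_on_shift E subspace_U)
  have Ee: "E (e i) = w i" if "i \<le> m" for i
    using that by (simp add: E_def extension_e deg)
  have Be: "B (e i) = (if even (m - i) then - e i else e (Suc i))" if "i < m" for i
    using that by (simp add: B_def Ee w_def shift_e)
  have Bem: "B (e m) = (x + y) \<cdot> e m + z - (x * y) \<cdot> e (m - 1)"
    unfolding xy by (simp add: B_def Ee w_def shift_e esm F.scale_left_diff_distrib)
  have Er: "E r = 0"
  proof -
    have "E r = (\<Sum>i<m. (if odd (m - i) then coord i (e (Suc m)) else 0) \<cdot> E (e i))"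
      unfolding r_def by (subst linear_on_sum[OF E]) (auto simp: linear_on_scale[OF E] subspace_fscale)
    also have "\<dots> = 0" by (intro sum.neutral) (auto simp: Ee w_def)
    finally show ?thesis .
  qed
  have Bz: "B z = - z"
  proof -
    have "B z = (\<Sum>i<m. (if even (m - i) then coord i (e (Suc m)) else 0) \<cdot> B (e i))"
      unfolding z_def by (subst linear_on_sum[OF B]) (auto simp: linear_on_scale[OF B] subspace_fscale)
    also have "\<dots> = - z" unfolding z_def sum_negf[symmetric] by (intro sum.cong) (auto simp: Be)
    finally show ?thesis .
  qed
  have z_pot: "z \<in> potents q U B"
    using Bz by (intro eigenvector_potent[OF B zU, of "-1"] field) simp
  have "E (E x) = E x" if "x \<in> U" for x
  proof (rule linear_on_eqI[OF linear_on_compose[OF E E] E _ that])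
    fix i assume "i < degree c"
    then consider "i < m" | "i = m" by (force simp: deg)
    then show "E (E (e i)) = E (e i)"
    proof cases
      case 1
      then show ?thesis
        by (cases "Suc i = m")
          (auto simp: Ee w_def linear_on_add[OF E] linear_on_zero[OF E])
    next
      case 2
      have "E (e (m - 1)) = 0" using m by (auto simp: Ee w_def)
      then have "E (w m) = E (e m)"
        using rU by (simp add: w_def linear_on_add[OF E] linear_on_scale[OF E] Er
            subspace_fscale subspace_add)
      then show ?thesis using 2 by (simp add: Ee)
    qed
  qed
  moreover have "(B ^^ q) u = B u" if "u \<in> U" for u
  proof (rule potents_all[OF B _ that])
    fix i assume "i < degree c"
    then consider "i < m" "even (m - i)" | "Suc i < m" "odd (m - i)" | "i = m - 1" | "i = m"
      by (force simp: deg)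
    moreover have "e m \<in> potents q U B \<and> e (m - 1) \<in> potents q U B"
    proof -
      have Bprev: "B (e (m - 1)) = e m" using m by (simp add: Be)
      from cond show ?thesis
      proof
        assume xy1: "x \<noteq> - 1 \<and> y \<noteq> - 1 \<and> x \<noteq> y"
        \<comment> \<open>The candidate eigenvector for the root \<open>a\<close> of \<open>X\<^sup>2 - (x + y) X + x y\<close> has an error \<open>z\<close>,
          which can be removed because \<open>a\<close> differs from the eigenvalue \<open>-1\<close> of \<open>z\<close>.\<close>
        have root: "e m - b \<cdot> e (m - 1) \<in> potents q U B"
          if ab: "a + b = x + y" "a * b = x * y" "a \<noteq> -1" for a b
        proof -
          define u where "u = e m - b \<cdot> e (m - 1)"
          have u: "u \<in> U" unfolding u_def by (intro subspace_diff subspace_fscale) auto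
          have a1: "a + 1 \<noteq> 0" using ab(3) by (simp add: add_eq_0_iff2)
          have "B u = B (e m) - b \<cdot> B (e (m - 1))"
            unfolding u_def by (simp add: linear_on_diff[OF B] linear_on_scale[OF B] subspace_fscale)
          also have "\<dots> = a \<cdot> u + z"
            unfolding Bem Bprev u_def ab(1,2)[symmetric]
            by (simp add: algebra_simps)
          finally have Bu: "B u = a \<cdot> u + z" .
          define u' where "u' = u + inverse (a + 1) \<cdot> z"
          have u': "u' \<in> U" unfolding u'_def using u zU by (intro subspace_add subspace_fscale) auto
          have "B u' = B u + inverse (a + 1) \<cdot> B z"
            unfolding u'_def using u zU
            by (simp add: linear_on_add[OF B] linear_on_scale[OF B] subspace_fscale)
          also have "\<dots> = a \<cdot> u + (1 - inverse (a + 1)) \<cdot> z"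
            by (simp add: Bu Bz F.scale_left_diff_distrib)
          also have "1 - inverse (a + 1) = a * inverse (a + 1)"
            using a1 by (simp add: field_simps)
          finally have "B u' = a \<cdot> u'" by (simp add: u'_def F.scale_right_distrib)
          then have "u' \<in> potents q U B" by (intro eigenvector_potent[OF B u'] field)
          then have "u' - inverse (a + 1) \<cdot> z \<in> potents q U B"
            by (intro potents_diff[OF B] potents_scale[OF B] z_pot) auto
          then show ?thesis by (simp add: u'_def u_def)
        qed
        have ux: "e m - y \<cdot> e (m - 1) \<in> potents q U B"
          using xy1 by (intro root[of x y]) auto
        have uy: "e m - x \<cdot> e (m - 1) \<in> potents q U B"
          using xy1 by (intro root[of y x]) (auto simp: ac_simps)
        have "(e m - y \<cdot> e (m - 1)) - (e m - x \<cdot> e (m - 1)) = (x - y) \<cdot> e (m - 1)"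
          by (simp add: F.scale_left_diff_distrib)
        then have "(x - y) \<cdot> e (m - 1) \<in> potents q U B"
          using potents_diff[OF B subspace_U ux uy] by simp
        then have "inverse (x - y) \<cdot> (x - y) \<cdot> e (m - 1) \<in> potents q U B"
          by (rule potents_scale[OF B subspace_U])
        moreover have "inverse (x - y) * (x - y) = 1" using xy1 by simp
        ultimately have prev: "e (m - 1) \<in> potents q U B"
          by (simp only: F.scale_scale F.scale_one)
        then have "(e m - y \<cdot> e (m - 1)) + y \<cdot> e (m - 1) \<in> potents q U B"
          by (intro potents_add[OF B] potents_scale[OF B] ux) auto
        then show ?thesis using prev by simp
      next
        assume xy2: "x = 0 \<and> y = 1 \<and> (2 :: 'f) = 0"
        then have neg: "- u = u" for u :: 'b using neg_eq_self by blast
        have Bm: "B (e m) = e m + z" using Bem xy2 by simp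
        have last: "e m \<in> potents q U B"
          using xy2 Bm Bz neg zU by (intro jordan_pair_potent[OF B _ zU _ _ q]) auto
        have "B (e (m - 1) - e m - z) = 0"
          using zU by (simp add: linear_on_diff[OF B] subspace_diff Bprev[simplified] Bm Bz)
        then have "e (m - 1) - e m - z \<in> potents q U B"
          using q0 zU by (intro kernel_potent[OF B] subspace_diff) auto
        then have "e (m - 1) - e m - z + z + e m \<in> potents q U B"
          by (intro potents_add[OF B] last z_pot) auto
        then show ?thesis using last by simp
      qed
    qed
    ultimately show "e i \<in> potents q U B"
    proof cases
      case 1
      then show ?thesis by (intro eigenvector_potent[OF B, of _ "-1"] field) (auto simp: Be)
    next
      case 2
      then have ev: "even (m - Suc i)" by auto
      then have "e (Suc i) \<in> potents q U B"
        using 2 by (intro eigenvector_potent[OF B, of _ "-1"] field) (auto simp: Be)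
      moreover have "e i + e (Suc i) \<in> potents q U B"
        using 2 ev q0
        by (intro kernel_potent[OF B]) (auto simp: Be linear_on_add[OF B] subspace_add)
      ultimately have "e i + e (Suc i) - e (Suc i) \<in> potents q U B"
        by (intro potents_diff[OF B]) auto
      then show ?thesis by simp
    qed auto
  qed
  moreover have "E x + B x = shift x" for x by (simp add: B_def)
  ultimately show ?thesis
    unfolding decomposable_def using E B
    by (intro exI[of _ E] exI[of _ B]) (auto simp: numeral_2_eq_2)
qed

text \<open>
  In odd characteristic the roots can be \<open>x\<close> and \<open>t - 1 - x\<close> for every \<open>x\<close> other than \<open>-1\<close>,
  \<open>t\<close> and \<open>(t - 1) / 2\<close>; such an \<open>x\<close> exists unless the field has order 3.
\<close>

lemma idempotent_plus_potent:
  assumes q: "odd q" and field: "\<And>a :: 'f. a ^ q = a"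
    and fin: "finite (UNIV :: 'f set)" and card: "card (UNIV :: 'f set) \<noteq> 3"
  shows "decomposable (\<lambda>s. s 2 = s 1) (\<lambda>s. s q = s 1) U"
proof (cases "degree c")
  case 0
  then show ?thesis using span_trivial decomposable_zero by simp
next
  case (Suc m)
  define t where "t = coord m (e (Suc m))"
  consider "m = 0 \<or> t \<noteq> 0 \<and> (t \<noteq> -1 \<or> (2 :: 'f) = 0)" | "m > 0" "t = 0" "(2 :: 'f) = 0"
    | "m > 0" "(2 :: 'f) \<noteq> 0" by blast
  then show ?thesis
  proof cases
    case 1
    then show ?thesis
      using idempotent_plus_potent_last_in_kernel[OF q field Suc t_def] by blast
  next
    case 2
    then have "(0 :: 'f) + 1 = t - 1"
      by (metis add_0 diff_0 eq_neg_iff_add_eq_0 one_add_one)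
    then show ?thesis
      using idempotent_plus_potent_last_in_image[OF q field Suc 2(1) t_def] 2 by blast
  next
    case 3
    have ne: "(1 :: 'f) \<noteq> -1"
      using 3(2) by (metis add.right_inverse one_add_one)
    have "card {0, 1, -1 :: 'f} = 3" using ne by simp
    then have "card (UNIV :: 'f set) > 3"
      using card card_mono[OF fin, of "{0, 1, -1}"] by simp
    moreover have "card {-1, t, (t - 1) / 2} \<le> 3"
      using card_insert_le_m1[of 3 "{t, (t - 1) / 2}" "-1"] card_insert_le_m1[of 2 "{(t - 1) / 2}" t]
      by simp
    ultimately have "\<exists>x. x \<notin> {-1, t, (t - 1) / 2}"
      by (metis UNIV_eq_I not_le)
    then obtain x where x: "x \<noteq> -1" "x \<noteq> t" "x \<noteq> (t - 1) / 2" by auto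
    have "x \<noteq> t - 1 - x"
    proof
      assume "x = t - 1 - x"
      then have "2 * x = t - 1" by (simp add: mult_2 algebra_simps)
      then show False using x(3) 3(2) by (simp add: field_simps)
    qed
    moreover have "t - 1 - x \<noteq> -1" using x(2) by simp
    ultimately show ?thesis
      using idempotent_plus_potent_last_in_image[OF q field Suc 3(1) t_def, of x "t - 1 - x"] x
      by simp
  qed
qed

end

section \<open>Matrices over finite fields\<close>

definition poly_action :: "('f::field \<Rightarrow> 'b::ab_group_add \<Rightarrow> 'b) \<Rightarrow> ('b \<Rightarrow> 'b) \<Rightarrow> 'f poly \<Rightarrow> 'b \<Rightarrow> 'b" where
  "poly_action s f p x = (\<Sum>k\<le>degree p. s (coeff p k) ((f ^^ k) x))"

context vector_space
begin

lemma poly_action_eq_sum: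
  assumes "degree p \<le> d"
  shows "poly_action scale f p x = (\<Sum>k\<le>d. coeff p k *s (f ^^ k) x)"
  unfolding poly_action_def using assms
  by (intro sum.mono_neutral_left) (auto simp: coeff_eq_0)

lemma polynomial_module_poly_action:
  assumes add: "\<And>x y. f (x + y) = f x + f y" and hom: "\<And>a x. f (a *s x) = a *s f x"
  shows "polynomial_module (poly_action scale f)"
proof -
  interpret f: additive f by standard (rule add)
  have pow_add: "(f ^^ k) (x + y) = (f ^^ k) x + (f ^^ k) y" for k x y
    by (induction k) (simp_all add: add)
  have action_add: "poly_action scale f (p + q) x = poly_action scale f p x + poly_action scale f q x"
    for p q x
  proof -
    let ?d = "max (degree p) (degree q)"
    show ?thesis
      using degree_add_le_max[of p q]
      by (simp add: poly_action_eq_sum[of _ ?d] scale_left_distrib sum.distrib)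
  qed
  have action_smult: "poly_action scale f (smult a p) x = a *s poly_action scale f p x" for a p x
    using degree_smult_le[of a p]
    by (simp add: poly_action_eq_sum[of _ "degree p"] scale_sum_right)
  have action_pCons: "poly_action scale f (pCons a p) x = a *s x + f (poly_action scale f p x)" for a p x
  proof -
    have "poly_action scale f (pCons a p) x = (\<Sum>k\<le>Suc (degree p). coeff (pCons a p) k *s (f ^^ k) x)"
      by (rule poly_action_eq_sum) (rule degree_pCons_le)
    also have "\<dots> = a *s x + (\<Sum>k\<le>degree p. coeff p k *s f ((f ^^ k) x))"
      by (subst sum.atMost_Suc_shift) simp
    finally show ?thesis
      by (simp add: poly_action_def f.sum hom)
  qed
  have action_zero: "poly_action scale f 0 x = 0" for x
    by (simp add: poly_action_def)
  have action_mult: "poly_action scale f (p * q) x = poly_action scale f p (poly_action scale f q x)"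
    for p q x
    by (induction p)
      (simp_all add: action_zero action_add action_smult action_pCons)
  show ?thesis
  proof (unfold_locales)
    show "poly_action scale f p (x + y) = poly_action scale f p x + poly_action scale f p y" for p x y
      by (simp add: poly_action_def pow_add scale_right_distrib sum.distrib)
    show "poly_action scale f 1 x = x" for x by (simp add: poly_action_def)
  qed (simp_all add: action_add action_mult)
qed

end

definition vec_scale :: "'f::field \<Rightarrow> (nat \<Rightarrow> 'f) \<Rightarrow> nat \<Rightarrow> 'f" where
  "vec_scale a x = (\<lambda>i. a * x i)"

definition mat_fun :: "'f::field mat \<Rightarrow> (nat \<Rightarrow> 'f) \<Rightarrow> nat \<Rightarrow> 'f" where
  "mat_fun M x = (\<lambda>i. if i < dim_row M then \<Sum>j\<in>{0..<dim_col M}. M $$ (i, j) * x j else 0)"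

definition unit_fun :: "nat \<Rightarrow> nat \<Rightarrow> 'f::field" where
  "unit_fun j = (\<lambda>i. if i = j then 1 else 0)"

text \<open>
  Vectors of length \<open>n\<close> are modelled by functions on the natural numbers that vanish from \<open>n\<close>
  on. For varying \<open>n\<close> they are subsets of one type, and that type is an additive group.
\<close>

definition vecs :: "nat \<Rightarrow> (nat \<Rightarrow> 'f::field) set" where
  "vecs n = {x. \<forall>i\<ge>n. x i = 0}"

lemma sum_fun_apply: "(\<Sum>j\<in>J. g j) i = (\<Sum>j\<in>J. g j i)"
  for g :: "'j \<Rightarrow> nat \<Rightarrow> 'f::field"
  by (induction J rule: infinite_finite_induct) simp_all

lemma vector_space_vec_scale: "vector_space (vec_scale :: 'f::field \<Rightarrow> _)"
  by unfold_locales (simp_all add: vec_scale_def fun_eq_iff algebra_simps)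

lemma mat_fun_mult:
  assumes "A \<in> carrier_mat n n" "B \<in> carrier_mat n n"
  shows "mat_fun (A * B) x = mat_fun A (mat_fun B x)"
proof
  fix i
  show "mat_fun (A * B) x i = mat_fun A (mat_fun B x) i"
  proof (cases "i < n")
    case True
    have "mat_fun (A * B) x i = (\<Sum>j\<in>{0..<n}. (\<Sum>k\<in>{0..<n}. A $$ (i, k) * B $$ (k, j)) * x j)"
      using assms True by (simp add: mat_fun_def scalar_prod_def)
    also have "\<dots> = (\<Sum>k\<in>{0..<n}. A $$ (i, k) * (\<Sum>j\<in>{0..<n}. B $$ (k, j) * x j))"
      unfolding sum_distrib_left sum_distrib_right
      by (subst sum.swap) (simp add: mult.assoc)
    also have "\<dots> = mat_fun A (mat_fun B x) i"
      using assms True by (simp add: mat_fun_def)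
    finally show ?thesis .
  qed (use assms in \<open>simp add: mat_fun_def\<close>)
qed

lemma mat_fun_one: "x \<in> vecs n \<Longrightarrow> mat_fun (1\<^sub>m n) x = x"
  by (auto simp: mat_fun_def vecs_def fun_eq_iff one_mat_def if_distrib[of "\<lambda>a. a * _"] cong: if_cong)

lemma mat_fun_unit:
  assumes "M \<in> carrier_mat n n" "i < n" "j < n"
  shows "mat_fun M (unit_fun j) i = M $$ (i, j)"
  using assms by (auto simp: mat_fun_def unit_fun_def if_distrib[of "\<lambda>a. _ * a"] cong: if_cong)

lemma unit_fun_in_vecs: "j < n \<Longrightarrow> unit_fun j \<in> vecs n"
  by (auto simp: vecs_def unit_fun_def)

lemma mat_eq_if_mat_fun_eq:
  assumes "M \<in> carrier_mat n n" "M' \<in> carrier_mat n n"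
    and "\<And>x. x \<in> vecs n \<Longrightarrow> mat_fun M x = mat_fun M' x"
  shows "M = M'"
proof (rule eq_matI)
  fix i j assume "i < dim_row M'" "j < dim_col M'"
  then have "i < n" "j < n" using assms by auto
  then show "M $$ (i, j) = M' $$ (i, j)"
    using assms(3)[OF unit_fun_in_vecs] mat_fun_unit[OF assms(1)] mat_fun_unit[OF assms(2)] by metis
qed (use assms in auto)

lemma finite_vecs:
  assumes "finite (UNIV :: 'f::field set)"
  shows "finite (vecs n :: (nat \<Rightarrow> 'f) set)"
proof -
  have "vecs n \<subseteq> {x :: nat \<Rightarrow> 'f. \<forall>i. (i \<in> {..<n} \<longrightarrow> x i \<in> UNIV) \<and> (i \<notin> {..<n} \<longrightarrow> x i = 0)}"
    by (auto simp: vecs_def)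
  then show ?thesis
    using finite_set_of_finite_funs[of "{..<n}" UNIV 0] assms by (auto intro: finite_subset)
qed

text \<open>
  The passage from operators to matrices. The vectors form a torsion module for the action of
  \<open>A\<close>, since over a finite field the vectors \<open>A\<^sup>k x\<close> cannot all be different.
\<close>

lemma matrix_plus_matrix:
  fixes A :: "'f::field mat"
  assumes fin: "finite (UNIV :: 'f set)" and A: "A \<in> carrier_mat n n"
    and zero: "P (\<lambda>_. 0)" "Q (\<lambda>_. 0)"
    and add: "\<And>s s'. P s \<Longrightarrow> P s' \<Longrightarrow> P (\<lambda>k. s k + s' k)"
      "\<And>s s'. Q s \<Longrightarrow> Q s' \<Longrightarrow> Q (\<lambda>k. s k + s' k)"
    and cyclic: "\<And>(scale :: 'f poly \<Rightarrow> (nat \<Rightarrow> 'f) \<Rightarrow> (nat \<Rightarrow> 'f)) v c. cyclic_module scale v c \<Longrightarrow>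
      polynomial_module.decomposable scale P Q (module.span scale {v})"
  shows "\<exists>E B. E \<in> carrier_mat n n \<and> B \<in> carrier_mat n n \<and> A = E + B \<and>
    (\<forall>x\<in>vecs n. P (\<lambda>k. mat_fun (E ^\<^sub>m k) x) \<and> Q (\<lambda>k. mat_fun (B ^\<^sub>m k) x))"
proof -
  let ?act = "poly_action vec_scale (mat_fun A)"
  interpret V: vector_space "vec_scale :: 'f \<Rightarrow> _" by (rule vector_space_vec_scale)
  interpret M: polynomial_module ?act
    by (rule V.polynomial_module_poly_action)
      (auto simp: mat_fun_def vec_scale_def fun_eq_iff algebra_simps sum.distrib sum_distrib_left)
  have fscale: "M.fscale a x = vec_scale a x" for a x
    by (simp add: M.fscale_def poly_action_def)
  have shift: "M.shift x = mat_fun A x" for x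
    by (simp add: poly_action_def)
  have closed: "mat_fun A x \<in> vecs n" for x
    using A by (auto simp: vecs_def mat_fun_def)
  have pow_closed: "x \<in> vecs n \<Longrightarrow> (mat_fun A ^^ k) x \<in> vecs n" for k x
    by (cases k) (simp_all add: closed)
  have sub: "V.subspace (vecs n)"
    by (rule V.subspaceI) (auto simp: vecs_def vec_scale_def)
  have subspace: "M.subspace (vecs n)"
    by (rule M.subspaceI)
      (auto simp: V.subspace_0[OF sub] V.subspace_add[OF sub] poly_action_def
        intro!: V.subspace_sum[OF sub] V.subspace_scale[OF sub] pow_closed)
  then have span: "M.span (vecs n) = vecs n" by simp
  have torsion: "\<exists>c. c \<noteq> 0 \<and> ?act c x = 0" if x: "x \<in> vecs n" for x
  proof -
    have "(\<lambda>k. ?act (monom 1 k) x) ` (UNIV :: nat set) \<subseteq> vecs n"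
      using M.subspace_scale[OF subspace x] by auto
    then have "finite ((\<lambda>k. ?act (monom 1 k) x) ` (UNIV :: nat set))"
      using finite_vecs[OF fin] by (rule finite_subset)
    then have "\<not> inj (\<lambda>k. ?act (monom 1 k) x)"
      using finite_imageD infinite_UNIV_nat by blast
    then obtain i j where "i \<noteq> j" "?act (monom 1 i) x = ?act (monom 1 j) x"
      by (auto simp: inj_def)
    then have "?act (monom 1 i - monom 1 j) x = 0" "monom 1 i - monom (1 :: 'f) j \<noteq> 0"
      by (auto simp: M.scale_left_diff_distrib monom_eq_iff')
    then show ?thesis by blast
  qed
  have "M.decomposable P Q (M.span (vecs n))"
  proof (rule M.decomposable_if_cyclic)
    show "M.decomposable P Q (M.span {a})"
      if "c \<noteq> 0" "\<And>h. ?act h a = 0 \<longleftrightarrow> c dvd h" for a c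
    proof -
      interpret cyclic_module ?act a c
        by unfold_locales (use that in auto)
      show ?thesis by (rule cyclic) unfold_locales
    qed
  qed (use finite_vecs[OF fin] torsion span zero add in auto)
  then obtain f g where fg: "M.linear_on (vecs n) f" "M.linear_on (vecs n) g"
    "\<And>x. x \<in> vecs n \<Longrightarrow> f x + g x = mat_fun A x \<and> P (\<lambda>k. (f ^^ k) x) \<and> Q (\<lambda>k. (g ^^ k) x)"
    unfolding span M.decomposable_def shift by blast
  define matrix where "matrix h = mat n n (\<lambda>(i, j). h (unit_fun j) i)" for h :: "(nat \<Rightarrow> 'f) \<Rightarrow> nat \<Rightarrow> 'f"
  have matrix_carrier [simp]: "matrix h \<in> carrier_mat n n" for h by (simp add: matrix_def)
  have matrix: "mat_fun (matrix h) x = h x" if h: "M.linear_on (vecs n) h" and x: "x \<in> vecs n" for h x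
  proof -
    have "x = (\<Sum>j\<in>{0..<n}. vec_scale (x j) (unit_fun j))"
      using x by (auto simp: fun_eq_iff sum_fun_apply vec_scale_def unit_fun_def vecs_def
          if_distrib[of "\<lambda>a. _ * a"] cong: if_cong)
    then have "h x = h (\<Sum>j\<in>{0..<n}. vec_scale (x j) (unit_fun j))" by simp
    also have "\<dots> = (\<Sum>j\<in>{0..<n}. h (vec_scale (x j) (unit_fun j)))"
      by (rule M.linear_on_sum[OF h subspace])
        (auto intro!: V.subspace_scale[OF sub] unit_fun_in_vecs)
    also have "\<dots> = (\<Sum>j\<in>{0..<n}. vec_scale (x j) (h (unit_fun j)))"
      using M.linear_on_scale[OF h] by (simp add: fscale unit_fun_in_vecs)
    finally have hx: "h x = (\<Sum>j\<in>{0..<n}. vec_scale (x j) (h (unit_fun j)))" .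
    have "h x \<in> vecs n" by (rule M.linear_on_closed[OF h x])
    then show ?thesis
      by (auto simp: fun_eq_iff mat_fun_def matrix_def hx sum_fun_apply vec_scale_def vecs_def mult.commute)
  qed
  have matrix_pow: "mat_fun (matrix h ^\<^sub>m k) x = (h ^^ k) x"
    if h: "M.linear_on (vecs n) h" and x: "x \<in> vecs n" for h x k
    using x
  proof (induction k arbitrary: x)
    case 0
    have "matrix h ^\<^sub>m 0 = 1\<^sub>m n" by (simp add: matrix_def)
    then show ?case using 0 by (simp only: mat_fun_one funpow_0)
  next
    case (Suc k)
    have "mat_fun (matrix h ^\<^sub>m Suc k) x = mat_fun (matrix h ^\<^sub>m k) (mat_fun (matrix h) x)"
      by (simp add: mat_fun_mult[of _ n])
    then show ?case
      using Suc M.linear_on_closed[OF h Suc.prems] by (simp add: matrix[OF h] funpow_swap1)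
  qed
  have "A = matrix f + matrix g"
  proof (rule mat_eq_if_mat_fun_eq[OF A])
    fix x :: "nat \<Rightarrow> 'f" assume x: "x \<in> vecs n"
    have "mat_fun (matrix f + matrix g) x = mat_fun (matrix f) x + mat_fun (matrix g) x"
      by (auto simp: mat_fun_def matrix_def fun_eq_iff distrib_right sum.distrib)
    then show "mat_fun A x = mat_fun (matrix f + matrix g) x"
      using fg(3)[OF x] matrix[OF fg(1) x] matrix[OF fg(2) x] by simp
  qed simp
  then show ?thesis
    using fg(3) matrix_pow[OF fg(1)] matrix_pow[OF fg(2)]
    by (intro exI[of _ "matrix f"] exI[of _ "matrix g"]) auto
qed

lemma matrix_idempotent_plus_potent:
  fixes A :: "'f::field mat"
  assumes fin: "finite (UNIV :: 'f set)" and card: "card (UNIV :: 'f set) \<noteq> 3"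
    and q: "odd q" and field: "\<And>a :: 'f. a ^ q = a" and A: "A \<in> carrier_mat n n"
  shows "\<exists>E B. E \<in> carrier_mat n n \<and> B \<in> carrier_mat n n \<and> E ^\<^sub>m 2 = E \<and> B ^\<^sub>m q = B \<and> A = E + B"
proof -
  obtain E B where EB: "E \<in> carrier_mat n n" "B \<in> carrier_mat n n" "A = E + B"
    "\<And>x. x \<in> vecs n \<Longrightarrow> mat_fun (E ^\<^sub>m 2) x = mat_fun (E ^\<^sub>m 1) x \<and> mat_fun (B ^\<^sub>m q) x = mat_fun (B ^\<^sub>m 1) x"
    using matrix_plus_matrix[of A n "\<lambda>s. s 2 = s 1" "\<lambda>s. s q = s 1"]
      cyclic_module.idempotent_plus_potent[OF _ q field fin card] fin A by auto
  have "E ^\<^sub>m 2 = E ^\<^sub>m 1" "B ^\<^sub>m q = B ^\<^sub>m 1"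
    using EB by (auto intro!: mat_eq_if_mat_fun_eq[of _ n] pow_carrier_mat simp del: pow_mat.simps)
  moreover have "E ^\<^sub>m 1 = E" "B ^\<^sub>m 1 = B" using EB(1,2) by simp_all
  ultimately show ?thesis using EB(1-3) by metis
qed

lemma matrix_nilpotent_plus_potent:
  fixes A :: "'f::field mat"
  assumes fin: "finite (UNIV :: 'f set)"
    and q: "odd q" and field: "\<And>a :: 'f. a ^ q = a" and A: "A \<in> carrier_mat n n"
  shows "\<exists>N B. N \<in> carrier_mat n n \<and> B \<in> carrier_mat n n \<and> N ^\<^sub>m 3 = 0\<^sub>m n n \<and> B ^\<^sub>m q = B \<and> A = N + B"
proof -
  obtain N B where NB: "N \<in> carrier_mat n n" "B \<in> carrier_mat n n" "A = N + B"
    "\<And>x. x \<in> vecs n \<Longrightarrow> mat_fun (N ^\<^sub>m 3) x = 0 \<and> mat_fun (B ^\<^sub>m q) x = mat_fun (B ^\<^sub>m 1) x"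
    using matrix_plus_matrix[of A n "\<lambda>s. s 3 = 0" "\<lambda>s. s q = s 1"]
      cyclic_module.nilpotent_plus_potent[OF _ q field] fin A by auto
  have zero: "mat_fun (0\<^sub>m n n :: 'f mat) x = 0" for x
    by (auto simp: mat_fun_def fun_eq_iff)
  have "N ^\<^sub>m 3 = 0\<^sub>m n n" "B ^\<^sub>m q = B ^\<^sub>m 1"
    using NB zero by (auto intro!: mat_eq_if_mat_fun_eq[of _ n] pow_carrier_mat simp del: pow_mat.simps)
  moreover have "B ^\<^sub>m 1 = B" using NB(2) by simp
  ultimately show ?thesis using NB(1-3) by metis
qed

section \<open>Sums of potents in a ring\<close>

lemma carrier_base [simp]: "carrier (base_ring TYPE('a::idom)) = UNIV"
  and mult_base [simp]: "monoid.mult (base_ring TYPE('a::idom)) = (*)"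
  and add_base [simp]: "add (base_ring TYPE('a::idom)) = (+)"
  and one_base [simp]: "one (base_ring TYPE('a::idom)) = 1"
  and zero_base [simp]: "zero (base_ring TYPE('a::idom)) = 0"
  by (simp_all add: ring_of_type_algebra_def fun_eq_iff)

lemma cring_base: "cring (base_ring TYPE('a::idom))"
  by (rule cring_from_type_algebra)

lemma pow_base [simp]: "x [^]\<^bsub>base_ring TYPE('a::idom)\<^esub> (k::nat) = x ^ k"
proof -
  interpret cring "base_ring TYPE('a)" by (rule cring_base)
  show ?thesis by (induction k) (simp_all add: mult.commute)
qed

lemma potent_base [simp]: "potent (base_ring TYPE('a::idom)) k x \<longleftrightarrow> x ^ k = x"
  by (simp add: potent_def)

lemma potent_matrix: "potent (matrix_ring TYPE('a::idom) n) k T \<longleftrightarrow> T \<in> carrier_mat n n \<and> T ^\<^sub>m k = T"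
  by (auto simp: potent_def ring_mat_simps pow_mat_ring_pow[symmetric, of _ n])

lemma nilpotent_matrix:
  "nilpotent_elem (matrix_ring TYPE('a::idom) n) T \<longleftrightarrow> T \<in> carrier_mat n n \<and> (\<exists>k>0. T ^\<^sub>m k = 0\<^sub>m n n)"
  by (auto simp: nilpotent_elem_def ring_mat_simps pow_mat_ring_pow[symmetric, of _ n])

text \<open>
  Because of the sign, a difference \<open>B - E\<close> with \<open>E\<close> idempotent is the sum of \<open>B\<close> and the
  tripotent \<open>- E\<close>; so the condition with tripotents is the weakest of those that concern
  idempotents.
\<close>

lemma (in ring) tripotent_idempotent:
  assumes "potent R 2 x"
  shows "potent R 3 x" and "potent R 3 (\<ominus> x)"
proof -
  have x: "x \<in> carrier R" "x \<otimes> x = x"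
    using assms by (auto simp: potent_def numeral_2_eq_2)
  then show "potent R 3 x" "potent R 3 (\<ominus> x)"
    by (auto simp: potent_def numeral_3_eq_3 l_minus r_minus)
qed

lemma (in ring) every_sum_tripotent_if_idempotent:
  assumes "every_sum R (potent R 2) Q"
  shows "every_sum R (potent R 3) Q"
  using assms tripotent_idempotent(1) unfolding every_sum_def by blast

lemma (in ring) every_sum_tripotent_if_sum_or_diff:
  assumes "every_sum_or_diff R (potent R q) (potent R 2)"
  shows "every_sum R (potent R 3) (potent R q)"
  unfolding every_sum_def
proof
  fix a assume "a \<in> carrier R"
  then obtain x y where xy: "potent R q x" "potent R 2 y" "a = x \<oplus> y \<or> a = x \<ominus> y"
    using assms unfolding every_sum_or_diff_def by blast
  then have "x \<in> carrier R" "y \<in> carrier R" by (auto simp: potent_def)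
  then have "a = y \<oplus> x \<or> a = \<ominus> y \<oplus> x"
    using xy(3) by (auto simp: a_minus_def a_comm)
  then show "\<exists>x y. potent R 3 x \<and> potent R q y \<and> a = x \<oplus> y"
    using tripotent_idempotent[OF xy(2)] xy(1) by blast
qed

lemma (in ring) every_sum_or_diff_if_idempotent:
  assumes "every_sum R (potent R 2) (potent R q)"
  shows "every_sum_or_diff R (potent R q) (potent R 2)"
  unfolding every_sum_or_diff_def
proof
  fix a assume "a \<in> carrier R"
  then obtain x y where xy: "potent R 2 x" "potent R q y" "a = x \<oplus> y"
    using assms unfolding every_sum_def by blast
  then have "a = y \<oplus> x" by (auto simp: a_comm potent_def)
  then show "\<exists>x y. potent R q x \<and> potent R 2 y \<and> (a = x \<oplus> y \<or> a = x \<ominus> y)"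
    using xy by blast
qed


section \<open>Scalar matrices\<close>

lemma pow_mat_Suc_vec:
  fixes M :: "'a::idom mat"
  assumes "M \<in> carrier_mat n n" "v \<in> carrier_vec n"
  shows "M ^\<^sub>m Suc k *\<^sub>v v = M ^\<^sub>m k *\<^sub>v (M *\<^sub>v v)"
  using assms by (simp add: assoc_mult_mat_vec[of _ n n _ n])

lemma mult_mat_smult_vec:
  fixes M :: "'a::idom mat"
  assumes "M \<in> carrier_mat n n" "v \<in> carrier_vec n"
  shows "M *\<^sub>v (a \<cdot>\<^sub>v v) = a \<cdot>\<^sub>v (M *\<^sub>v v)"
  using assms by (intro eq_vecI) (auto simp: scalar_prod_def sum_distrib_left ac_simps)

lemma pow_mat_eigenvector:
  fixes M :: "'a::idom mat"
  assumes M: "M \<in> carrier_mat n n" and v: "v \<in> carrier_vec n" and eig: "M *\<^sub>v v = a \<cdot>\<^sub>v v"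
  shows "(M ^\<^sub>m k) *\<^sub>v v = a ^ k \<cdot>\<^sub>v v"
proof (induction k)
  case 0
  then show ?case using M v by simp
next
  case (Suc k)
  have "(M ^\<^sub>m Suc k) *\<^sub>v v = (M ^\<^sub>m k) *\<^sub>v (a \<cdot>\<^sub>v v)"
    by (simp only: pow_mat_Suc_vec[OF M v] eig)
  also have "\<dots> = a \<cdot>\<^sub>v ((M ^\<^sub>m k) *\<^sub>v v)"
    by (rule mult_mat_smult_vec[OF pow_carrier_mat[OF M] v])
  finally show ?case by (simp add: Suc smult_smult_assoc)
qed

text \<open>
  On an eigenvector of \<open>E\<close> for \<open>l\<close> the matrix \<open>B = a 1 - E\<close> acts as the scalar \<open>a - l\<close>, which
  inherits \<open>q\<close>-potency.
\<close>

lemma potent_eigenvalue_if_scalar_sum: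
  fixes a :: "'a::idom"
  assumes E: "E \<in> carrier_mat n n" and B: "B \<in> carrier_mat n n" and sum: "a \<cdot>\<^sub>m 1\<^sub>m n = E + B"
    and q: "B ^\<^sub>m q = B" and v: "v \<in> carrier_vec n" "v \<noteq> 0\<^sub>v n" and eig: "E *\<^sub>v v = l \<cdot>\<^sub>v v"
  shows "(a - l) ^ q = a - l"
proof -
  have "(a \<cdot>\<^sub>m 1\<^sub>m n) *\<^sub>v v = a \<cdot>\<^sub>v v" 
    using v by (intro eq_vecI)
      (auto simp: scalar_prod_def if_distrib[of "\<lambda>x. a * x"] if_distrib[of "\<lambda>x. x * _"] cong: if_cong)
  then have *: "E *\<^sub>v v + B *\<^sub>v v = a \<cdot>\<^sub>v v"
    using E B v by (simp add: sum add_mult_distrib_mat_vec[of _ n n])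
  have "B *\<^sub>v v = (a - l) \<cdot>\<^sub>v v"
  proof (rule eq_vecI)
    fix i assume "i < dim_vec ((a - l) \<cdot>\<^sub>v v)"
    then have i: "i < n" using v by simp
    then have "(E *\<^sub>v v + B *\<^sub>v v) $ i = (a \<cdot>\<^sub>v v) $ i" using * by simp
    then have "l * v $ i + (B *\<^sub>v v) $ i = a * v $ i"
      using i v B by (simp add: eig del: index_mult_mat_vec)
    then show "(B *\<^sub>v v) $ i = ((a - l) \<cdot>\<^sub>v v) $ i"
      using i v by (simp add: algebra_simps del: index_mult_mat_vec)
  qed (use B v in auto)
  then have "(a - l) ^ q \<cdot>\<^sub>v v = (a - l) \<cdot>\<^sub>v v"
    using pow_mat_eigenvector[OF B v(1), of "a - l" q] q by simp
  moreover obtain i where "i < n" "v $ i \<noteq> 0"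
    using v by (metis carrier_vecD eq_vecI index_zero_vec)
  ultimately show ?thesis
    using v by (metis carrier_vecD index_smult_vec(1) mult_cancel_right)
qed

text \<open>
  Found without division, hence over every integral domain: for \<open>v \<noteq> 0\<close> and \<open>u = E v\<close> one has
  \<open>E\<^sup>2 u = u\<close>. If \<open>u = 0\<close> the eigenvalue is \<open>0\<close>; otherwise \<open>w = E u + u\<close> is fixed by \<open>E\<close>, and
  if it vanishes then \<open>E u = - u\<close>.
\<close>

lemma tripotent_matrix_eigenvector:
  fixes E :: "'a::idom mat"
  assumes E: "E \<in> carrier_mat n n" "E ^\<^sub>m 3 = E" and n: "n > 0"
  obtains v l where "v \<in> carrier_vec n" "v \<noteq> 0\<^sub>v n" "E *\<^sub>v v = l \<cdot>\<^sub>v v" "l \<in> {0, 1, -1}"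
proof -
  define v :: "'a vec" where "v = unit_vec n 0"
  have v: "v \<in> carrier_vec n" "v \<noteq> 0\<^sub>v n"
    using n unit_vec_nonzero[of 0 n] by (auto simp: v_def)
  define u where "u = E *\<^sub>v v"
  have u: "u \<in> carrier_vec n" using E v by (simp add: u_def)
  have "E ^\<^sub>m 3 *\<^sub>v v = E *\<^sub>v (E *\<^sub>v u)"
    using E(1) v u by (simp add: numeral_3_eq_3 u_def pow_mat_Suc_vec[of _ n] del: pow_mat.simps(2))
  then have EEu: "E *\<^sub>v (E *\<^sub>v u) = u" using E by (simp add: u_def)
  define w where "w = E *\<^sub>v u + u"
  have w: "w \<in> carrier_vec n" using E u by (simp add: w_def)
  have Eu: "E *\<^sub>v u \<in> carrier_vec n" using E u by simp
  consider "u = 0\<^sub>v n" | "u \<noteq> 0\<^sub>v n" "w = 0\<^sub>v n" | "w \<noteq> 0\<^sub>v n" by blast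
  then show thesis
  proof cases
    case 1
    then show thesis using v by (intro that[of v 0]) (auto simp: u_def)
  next
    case 2
    have "E *\<^sub>v u = - 1 \<cdot>\<^sub>v u"
    proof (rule eq_vecI)
      fix i assume "i < dim_vec (- 1 \<cdot>\<^sub>v u)"
      then have i: "i < n" using u by simp
      have "w $ i = 0" using 2 i by simp
      then show "(E *\<^sub>v u) $ i = (- 1 \<cdot>\<^sub>v u) $ i"
        using i u Eu by (simp add: w_def add_eq_0_iff2 del: index_mult_mat_vec)
    qed (use E u in auto)
    then show thesis using u 2 by (intro that[of u "-1"]) auto
  next
    case 3
    have "E *\<^sub>v w = E *\<^sub>v (E *\<^sub>v u) + E *\<^sub>v u"
      unfolding w_def by (rule mult_add_distrib_mat_vec[OF E(1) Eu u])
    also have "\<dots> = w" unfolding EEu w_def using u Eu by (rule comm_add_vec)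
    finally show thesis using w 3 by (intro that[of w 1]) auto
  qed
qed

lemma nilpotent_matrix_kernel:
  fixes N :: "'a::idom mat"
  assumes N: "N \<in> carrier_mat n n" "N ^\<^sub>m k = 0\<^sub>m n n" and n: "n > 0"
  obtains v where "v \<in> carrier_vec n" "v \<noteq> 0\<^sub>v n" "N *\<^sub>v v = 0\<^sub>v n"
proof -
  have *: "\<exists>u. u \<in> carrier_vec n \<and> u \<noteq> 0\<^sub>v n \<and> N *\<^sub>v u = 0\<^sub>v n"
    if "v \<in> carrier_vec n" "v \<noteq> 0\<^sub>v n" "(N ^\<^sub>m k) *\<^sub>v v = 0\<^sub>v n" for v k
    using that
  proof (induction k arbitrary: v)
    case 0
    then show ?case using N(1) by simp
  next
    case (Suc k)
    have "(N ^\<^sub>m k) *\<^sub>v (N *\<^sub>v v) = 0\<^sub>v n"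
      using Suc.prems N(1) by (simp only: pow_mat_Suc_vec[of _ n])
    then show ?case
      using Suc.IH[of "N *\<^sub>v v"] Suc.prems N(1) by (cases "N *\<^sub>v v = 0\<^sub>v n") auto
  qed
  have "unit_vec n 0 \<in> carrier_vec n" "unit_vec n 0 \<noteq> (0\<^sub>v n :: 'a vec)"
    using n unit_vec_nonzero[of 0 n] by auto
  moreover have "(N ^\<^sub>m k) *\<^sub>v unit_vec n 0 = 0\<^sub>v n"
    unfolding N(2) by (intro eq_vecI) auto
  ultimately show thesis using * that by blast
qed

lemma covered_if_matrix_tripotent_sum:
  fixes a :: "'a::idom"
  assumes "n > 0"
    and "every_sum (matrix_ring TYPE('a) n) (tripotent_elem (matrix_ring TYPE('a) n)) (potent (matrix_ring TYPE('a) n) q)"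
  shows "a ^ q = a \<or> (a + 1) ^ q = a + 1 \<or> (a - 1) ^ q = a - 1"
proof -
  have "a \<cdot>\<^sub>m 1\<^sub>m n \<in> carrier_mat n n" by simp
  then obtain E B where EB: "E \<in> carrier_mat n n" "E ^\<^sub>m 3 = E" "B \<in> carrier_mat n n" "B ^\<^sub>m q = B"
    "a \<cdot>\<^sub>m 1\<^sub>m n = E + B"
    using assms(2) unfolding every_sum_def potent_matrix ring_mat_simps by blast
  obtain v l where "v \<in> carrier_vec n" "v \<noteq> 0\<^sub>v n" "E *\<^sub>v v = l \<cdot>\<^sub>v v" "l \<in> {0, 1, -1}"
    using tripotent_matrix_eigenvector[OF EB(1,2) assms(1)] by metis
  then show ?thesis
    using potent_eigenvalue_if_scalar_sum[OF EB(1,3,5,4), of v l] by auto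
qed

lemma potent_if_matrix_nilpotent_sum:
  fixes a :: "'a::idom"
  assumes "n > 0"
    and "every_sum (matrix_ring TYPE('a) n) (nilpotent_elem (matrix_ring TYPE('a) n)) (potent (matrix_ring TYPE('a) n) q)"
  shows "a ^ q = a"
proof -
  have "a \<cdot>\<^sub>m 1\<^sub>m n \<in> carrier_mat n n" by simp
  then obtain N B k where NB: "N \<in> carrier_mat n n" "N ^\<^sub>m k = 0\<^sub>m n n" "B \<in> carrier_mat n n" "B ^\<^sub>m q = B"
    "a \<cdot>\<^sub>m 1\<^sub>m n = N + B"
    using assms(2) unfolding every_sum_def potent_matrix nilpotent_matrix ring_mat_simps by blast
  obtain v where v: "v \<in> carrier_vec n" "v \<noteq> 0\<^sub>v n" "N *\<^sub>v v = 0\<^sub>v n"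
    using nilpotent_matrix_kernel[OF NB(1,2) assms(1)] by metis
  then have "N *\<^sub>v v = 0 \<cdot>\<^sub>v v" by auto
  then show ?thesis
    using potent_eigenvalue_if_scalar_sum[OF NB(1,3,5,4) v(1,2), of 0] by simp
qed

lemma covered_if_tripotent_sum:
  fixes a :: "'a::idom"
  assumes "every_sum (base_ring TYPE('a)) (tripotent_elem (base_ring TYPE('a))) (potent (base_ring TYPE('a)) q)"
  shows "a ^ q = a \<or> (a + 1) ^ q = a + 1 \<or> (a - 1) ^ q = a - 1"
proof -
  have "\<exists>x. x ^ 3 = x \<and> (\<exists>y. y ^ q = y \<and> a = x + y)"
    using assms by (simp add: every_sum_def)
  then obtain x y where xy: "x ^ 3 = x" "y ^ q = y" "a = x + y" by blast
  have "x * (x - 1) * (x + 1) = 0"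
    using xy(1) by (simp add: power3_eq_cube algebra_simps)
  then have "x = 0 \<or> x = 1 \<or> x = -1" by (auto simp: add_eq_0_iff2)
  then show ?thesis using xy by auto
qed


section \<open>Finite integral domains\<close>

text \<open>
  A nonzero polynomial over a domain has finitely many roots, so there are finitely many
  \<open>q\<close>-potents, and three translates of them cover the ring.
\<close>

lemma finite_if_covered:
  assumes q: "q > 1"
    and cover: "\<And>a :: 'a::idom. a ^ q = a \<or> (a + 1) ^ q = a + 1 \<or> (a - 1) ^ q = a - 1"
  shows "finite (UNIV :: 'a set)"
proof -
  let ?S = "{a :: 'a. a ^ q = a}"
  let ?p = "monom 1 q - monom 1 1 :: 'a poly"
  have "coeff ?p q = 1" using q by simp
  then have "?p \<noteq> 0" by (metis coeff_0 zero_neq_one)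
  then have "finite {a. poly ?p a = 0}" by (rule poly_roots_finite)
  then have S: "finite ?S" by (simp add: poly_monom)
  have "UNIV \<subseteq> ?S \<union> (\<lambda>a. a - 1) ` ?S \<union> (\<lambda>a. a + 1) ` ?S"
    using cover by (force simp: image_iff)
  then show ?thesis using S by (auto intro: finite_subset)
qed

lemma finite_domain_inverse:
  fixes a :: "'a::idom"
  assumes "finite (UNIV :: 'a set)" "a \<noteq> 0"
  obtains b where "a * b = 1"
proof -
  have "inj (\<lambda>x. a * x)" using assms(2) by (simp add: inj_def)
  then have "surj (\<lambda>x. a * x)" using assms(1) finite_UNIV_inj_surj by blast
  then show thesis using that by (metis surjD)
qed

text \<open>
  A finite domain is a field, though not one by type class; its fraction field is an
  isomorphic copy that does belong to the class of fields. Results on fields are applied to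
  the copy and transported back.
\<close>

lemma bij_to_fract:
  assumes "finite (UNIV :: 'a::idom set)"
  shows "bij (to_fract :: 'a \<Rightarrow> _)"
proof (rule bijI)
  show "inj (to_fract :: 'a \<Rightarrow> _)" by (simp add: inj_def)
  show "surj (to_fract :: 'a \<Rightarrow> _)"
  proof (unfold surj_def, rule allI)
    fix y :: "'a fract"
    obtain a b where ab: "y = Fract a b" "b \<noteq> 0" by (cases y)
    obtain c where "b * c = 1" using finite_domain_inverse[OF assms ab(2)] .
    then have "y = to_fract (a * c)"
      using ab by (simp add: to_fract_def eq_fract mult.assoc mult.commute[of c] del: to_fract_mult)
    then show "\<exists>x. y = to_fract x" ..
  qed
qed

lemma field_base:
  assumes "finite (UNIV :: 'a::idom set)"
  shows "field (base_ring TYPE('a))"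
proof -
  interpret cring "base_ring TYPE('a)" by (rule cring_base)
  show ?thesis
  proof (rule cring_fieldI2)
    fix a assume "a \<noteq> \<zero>\<^bsub>base_ring TYPE('a)\<^esub>"
    then obtain b where "a * b = 1" using finite_domain_inverse[OF assms, of a] by auto
    then show "\<exists>b\<in>carrier (base_ring TYPE('a)). a \<otimes>\<^bsub>base_ring TYPE('a)\<^esub> b = \<one>\<^bsub>base_ring TYPE('a)\<^esub>"
      by auto
  qed simp
qed

text \<open>
  The structure of a finite domain is transported to the natural numbers along an injection.
\<close>

lemma iso_to_GF_card:
  assumes "finite (UNIV :: 'a::idom set)"
  shows "iso_to_GF (base_ring TYPE('a)) (card (UNIV :: 'a set))"
proof -
  interpret field "base_ring TYPE('a)" by (rule field_base[OF assms])
  obtain f :: "'a \<Rightarrow> nat" where f: "inj f"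
    using finite_imp_inj_to_nat_seg[OF assms] by auto
  let ?F = "image_ring f (base_ring TYPE('a))"
  have "field ?F" using f by (intro inj_imp_image_ring_is_field) simp
  moreover have "base_ring TYPE('a) \<simeq> ?F"
    using f inj_imp_image_ring_iso[of f "base_ring TYPE('a)"] by (auto simp: is_ring_iso_def)
  moreover have "Coset.order ?F = card (UNIV :: 'a set)"
    using f by (simp add: Coset.order_def image_ring_carrier card_image)
  ultimately show ?thesis unfolding iso_to_GF_def by blast
qed

text \<open>
  The multiplicative group of a finite field is cyclic, and the order \<open>|R| - 1\<close> of a generator
  divides \<open>q - 1\<close> if its power with exponent \<open>q - 1\<close> is \<open>1\<close>; the converse is Lagrange's
  theorem.
\<close>

lemma all_potent_iff:
  assumes q: "q > 1"
  shows "(\<forall>a :: 'a::idom. a ^ q = a) \<longleftrightarrow>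
    field (base_ring TYPE('a)) \<and> finite (carrier (base_ring TYPE('a))) \<and> Coset.order (base_ring TYPE('a)) - 1 dvd q - 1"
    (is "_ \<longleftrightarrow> field ?R \<and> _")
proof
  assume pot: "\<forall>a :: 'a. a ^ q = a"
  then have fin: "finite (UNIV :: 'a set)" using finite_if_covered[OF q] by blast
  interpret field ?R by (rule field_base[OF fin])
  interpret G: group "Multiplicative_Group.mult_of ?R" by (rule field_mult_group)
  have finG: "finite (carrier (Multiplicative_Group.mult_of ?R))" using fin by simp
  obtain a where a: "a \<in> carrier (Multiplicative_Group.mult_of ?R)" "carrier (Multiplicative_Group.mult_of ?R) = {a [^]\<^bsub>?R\<^esub> i | i::nat. i \<in> UNIV}"
    using finite_field_mult_group_has_gen fin by auto
  have "carrier (Multiplicative_Group.mult_of ?R) \<subseteq> generate (Multiplicative_Group.mult_of ?R) {a}"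
    using G.generate_pow_nat[OF a(1)] G.ord_ge_1[OF finG a(1)] a(2) by (auto simp: Multiplicative_Group.nat_pow_mult_of)
  then have "carrier (Multiplicative_Group.mult_of ?R) = generate (Multiplicative_Group.mult_of ?R) {a}"
    using G.generate_incl[of "{a}"] a(1) by auto
  then have ord: "G.ord a = Coset.order ?R - 1"
    using G.generate_pow_card[OF a(1)] order_mult_of fin by (simp add: Coset.order_def)
  have "a ^ (q - 1) * a = 1 * a"
    using pot power_minus_mult[of q a] q by (simp only: mult_1)
  then have "a ^ (q - 1) = 1" using a(1) by simp
  then have "a [^]\<^bsub>Multiplicative_Group.mult_of ?R\<^esub> (q - 1) = \<one>\<^bsub>Multiplicative_Group.mult_of ?R\<^esub>" by (simp add: Multiplicative_Group.nat_pow_mult_of)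
  then show "field ?R \<and> finite (carrier ?R) \<and> Coset.order ?R - 1 dvd q - 1"
    using G.pow_eq_id[OF a(1)] ord field_axioms fin by simp
next
  assume R: "field ?R \<and> finite (carrier ?R) \<and> Coset.order ?R - 1 dvd q - 1"
  interpret field ?R using R by simp
  interpret G: group "Multiplicative_Group.mult_of ?R" by (rule field_mult_group)
  show "\<forall>a :: 'a. a ^ q = a"
  proof
    fix a :: 'a
    show "a ^ q = a"
    proof (cases "a = 0")
      case False
      then have a: "a \<in> carrier (Multiplicative_Group.mult_of ?R)" by simp
      have "a [^]\<^bsub>Multiplicative_Group.mult_of ?R\<^esub> (Coset.order ?R - 1) = \<one>\<^bsub>Multiplicative_Group.mult_of ?R\<^esub>"
        using G.pow_order_eq_1[OF a] order_mult_of R by simp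
      then have "a ^ (Coset.order ?R - 1) = 1" by (simp add: Multiplicative_Group.nat_pow_mult_of)
      then have "a ^ (q - 1) = 1" using R by (metis dvdE power_mult power_one)
      then show ?thesis using q power_minus_mult[of q a] by simp
    qed (use q in simp)
  qed
qed

lemma to_fract_power: "to_fract (a ^ k) = to_fract a ^ k"
  by (induction k) simp_all

lemma all_potent_if_covered:
  assumes fin: "finite (UNIV :: 'a::idom set)" and q: "q > 1" "odd q"
    and cover: "\<And>a :: 'a. a ^ q = a \<or> (a + 1) ^ q = a + 1 \<or> (a - 1) ^ q = a - 1"
    and card: "card (UNIV :: 'a set) \<noteq> 5" "card (UNIV :: 'a set) \<noteq> 9"
  shows "(a :: 'a) ^ q = a"
proof -
  have bij: "bij (to_fract :: 'a \<Rightarrow> _)" by (rule bij_to_fract[OF fin])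
  have card': "card (UNIV :: 'a fract set) = card (UNIV :: 'a set)"
    using bij_betw_same_card[OF bij] by simp
  have fin': "finite (UNIV :: 'a fract set)"
    using bij fin bij_betw_finite by blast
  have "to_fract a ^ q = to_fract a"
  proof (rule potent_translates_cover[OF fin' q])
    fix b :: "'a fract"
    obtain c where b: "b = to_fract c" using bij by (metis bij_pointE)
    have "b + 1 = to_fract (c + 1)" "b - 1 = to_fract (c - 1)"
      by (simp_all add: b)
    then show "b ^ q = b \<or> (b + 1) ^ q = b + 1 \<or> (b - 1) ^ q = b - 1"
      using cover[of c] by (metis b to_fract_power)
  qed (use card card' in auto)
  then show ?thesis by (simp add: to_fract_power[symmetric])
qed


section \<open>Matrices over finite integral domains\<close>

lemma comm_ring_hom_inv_to_fract:
  assumes "finite (UNIV :: 'a::idom set)"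
  shows "comm_ring_hom (inv_into UNIV (to_fract :: 'a \<Rightarrow> _))"
proof -
  have inj: "inj (to_fract :: 'a \<Rightarrow> _)"
    and inv: "to_fract (inv_into UNIV to_fract y) = y" for y :: "'a fract"
    using bij_to_fract[OF assms] by (simp_all add: bij_def surj_f_inv_f)
  show ?thesis
    by unfold_locales
      (auto intro!: injD[OF inj] simp: inv)
qed

lemma finite_domain_matrix_sum:
  assumes fin: "finite (UNIV :: 'a::idom set)" and A: "(A :: 'a mat) \<in> carrier_mat n n"
    and sum: "\<And>A' :: 'a fract mat. A' \<in> carrier_mat n n \<Longrightarrow>
      \<exists>E B. E \<in> carrier_mat n n \<and> B \<in> carrier_mat n n \<and> P E \<and> B ^\<^sub>m q = B \<and> A' = E + B"
  shows "\<exists>E' B. E' \<in> carrier_mat n n \<and> P E' \<and> B \<in> carrier_mat n n \<and> B ^\<^sub>m q = B \<and>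
    A = map_mat (inv_into UNIV to_fract) E' + B"
proof -
  let ?g = "inv_into UNIV (to_fract :: 'a \<Rightarrow> _)"
  interpret g: comm_ring_hom ?g by (rule comm_ring_hom_inv_to_fract[OF fin])
  have inj: "inj (to_fract :: 'a \<Rightarrow> _)" using bij_to_fract[OF fin] by (simp add: bij_def)
  obtain E B where EB: "E \<in> carrier_mat n n" "B \<in> carrier_mat n n" "P E" "B ^\<^sub>m q = B"
    "map_mat to_fract A = E + B"
    using sum[of "map_mat to_fract A"] A by auto
  have "A = map_mat ?g (map_mat to_fract A)"
    by (rule eq_matI) (auto simp: inv_f_f[OF inj])
  also have "\<dots> = map_mat ?g E + map_mat ?g B"
    unfolding EB(5) using EB(1,2) by (intro eq_matI) (auto simp: g.hom_add)
  finally show ?thesis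
    using EB g.mat_hom_pow[OF EB(2), of q] by (metis map_carrier_mat)
qed

lemma every_matrix_idempotent_plus_potent:
  assumes fin: "finite (UNIV :: 'a::idom set)" and card: "card (UNIV :: 'a set) \<noteq> 3"
    and q: "odd q" and pot: "\<And>a :: 'a. a ^ q = a"
  shows "every_sum (matrix_ring TYPE('a) n) (idempotent_elem (matrix_ring TYPE('a) n))
    (potent (matrix_ring TYPE('a) n) q)"
  unfolding every_sum_def potent_matrix ring_mat_simps
proof
  fix A :: "'a mat" assume A: "A \<in> carrier_mat n n"
  let ?g = "inv_into UNIV (to_fract :: 'a \<Rightarrow> _)"
  interpret g: comm_ring_hom ?g by (rule comm_ring_hom_inv_to_fract[OF fin])
  have bij: "bij (to_fract :: 'a \<Rightarrow> _)" by (rule bij_to_fract[OF fin])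
  have fin': "finite (UNIV :: 'a fract set)" using bij fin bij_betw_finite by blast
  have card': "card (UNIV :: 'a fract set) \<noteq> 3" using bij_betw_same_card[OF bij] card by simp
  have pot': "b ^ q = b" for b :: "'a fract"
    using pot by (metis bij bij_pointE to_fract_power)
  obtain E B where "E \<in> carrier_mat n n" "E ^\<^sub>m 2 = E" "B \<in> carrier_mat n n" "B ^\<^sub>m q = B"
    "A = map_mat ?g E + B"
    using finite_domain_matrix_sum[of A n "\<lambda>E. E ^\<^sub>m 2 = E" q, OF fin A
        matrix_idempotent_plus_potent[OF fin' card' q pot']] by blast
  then show "\<exists>E B. (E \<in> carrier_mat n n \<and> E ^\<^sub>m 2 = E) \<and> (B \<in> carrier_mat n n \<and> B ^\<^sub>m q = B) \<and> A = E + B"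
    using g.mat_hom_pow[of E n 2] by (metis map_carrier_mat)
qed

lemma every_matrix_nilpotent_plus_potent:
  assumes fin: "finite (UNIV :: 'a::idom set)"
    and q: "odd q" and pot: "\<And>a :: 'a. a ^ q = a"
  shows "every_sum (matrix_ring TYPE('a) n) (nilpotent_elem (matrix_ring TYPE('a) n))
    (potent (matrix_ring TYPE('a) n) q)"
  unfolding every_sum_def potent_matrix nilpotent_matrix ring_mat_simps
proof
  fix A :: "'a mat" assume A: "A \<in> carrier_mat n n"
  let ?g = "inv_into UNIV (to_fract :: 'a \<Rightarrow> _)"
  interpret g: comm_ring_hom ?g by (rule comm_ring_hom_inv_to_fract[OF fin])
  have bij: "bij (to_fract :: 'a \<Rightarrow> _)" by (rule bij_to_fract[OF fin])
  have fin': "finite (UNIV :: 'a fract set)" using bij fin bij_betw_finite by blast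
  have pot': "b ^ q = b" for b :: "'a fract"
    using pot by (metis bij bij_pointE to_fract_power)
  obtain N B where *: "N \<in> carrier_mat n n" "N ^\<^sub>m 3 = 0\<^sub>m n n" "B \<in> carrier_mat n n" "B ^\<^sub>m q = B"
    "A = map_mat ?g N + B"
    using finite_domain_matrix_sum[of A n "\<lambda>N. N ^\<^sub>m 3 = 0\<^sub>m n n" q, OF fin A
        matrix_nilpotent_plus_potent[OF fin' q pot']] by blast
  have zero: "map_mat ?g (0\<^sub>m n n) = 0\<^sub>m n n" by (intro eq_matI) auto
  from * have "map_mat ?g N ^\<^sub>m 3 = 0\<^sub>m n n"
    using g.mat_hom_pow[of N n 3] zero by metis
  then show "\<exists>N B. (N \<in> carrier_mat n n \<and> (\<exists>k>0. N ^\<^sub>m k = 0\<^sub>m n n)) \<and>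
      (B \<in> carrier_mat n n \<and> B ^\<^sub>m q = B) \<and> A = N + B"
    using * by (metis map_carrier_mat zero_less_numeral)
qed


section \<open>The equivalence\<close>

theorem theorem1p1:
  fixes q :: nat
  defines "R \<equiv> base_ring TYPE('a::idom)"
    and "M \<equiv> matrix_ring TYPE('a)"
  assumes "q > 1" and "odd q"
    and "\<not> iso_to_GF R 3" and "\<not> iso_to_GF R 5" and "\<not> iso_to_GF R 9"
  shows "all_equivalent
    [\<forall>n>0. every_sum (M n) (idempotent_elem (M n)) (potent (M n) q),
     \<exists>n>0. every_sum (M n) (idempotent_elem (M n)) (potent (M n) q),
     \<forall>n>0. every_sum (M n) (nilpotent_elem (M n)) (potent (M n) q),
     \<exists>n>0. every_sum (M n) (nilpotent_elem (M n)) (potent (M n) q),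
     \<forall>n>0. every_sum (M n) (tripotent_elem (M n)) (potent (M n) q),
     \<exists>n>0. every_sum (M n) (tripotent_elem (M n)) (potent (M n) q),
     \<forall>n>0. every_sum_or_diff (M n) (potent (M n) q) (idempotent_elem (M n)),
     \<exists>n>0. every_sum_or_diff (M n) (potent (M n) q) (idempotent_elem (M n)),
     every_sum R (potent R q) (tripotent_elem R),
     every_sum_or_diff R (potent R q) (idempotent_elem R),
     field R \<and> finite (carrier R) \<and> Coset.order R - 1 dvd q - 1]"
proof -
  have ring_M: "ring (M n)" for n unfolding M_def by (rule ring_mat)
  interpret R: cring R unfolding R_def by (rule cring_base)
  define F where "F \<longleftrightarrow> (\<forall>a :: 'a. a ^ q = a)"
  define cov where "cov \<longleftrightarrow> (\<forall>a :: 'a. a ^ q = a \<or> (a + 1) ^ q = a + 1 \<or> (a - 1) ^ q = a - 1)"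
  have card: "card (UNIV :: 'a set) \<notin> {3, 5, 9}" if "finite (UNIV :: 'a set)"
    using iso_to_GF_card[OF that] assms(5-7) unfolding R_def by auto
  have covF: "F" if "cov"
  proof -
    have fin: "finite (UNIV :: 'a set)"
      using that assms(3) unfolding cov_def by (intro finite_if_covered[of q]) auto
    show ?thesis unfolding F_def
      using that card[OF fin] unfolding cov_def
      by (intro allI all_potent_if_covered[OF fin assms(3,4)]) auto
  qed
  have F7: "(field R \<and> finite (carrier R) \<and> Coset.order R - 1 dvd q - 1) \<longleftrightarrow> F"
    unfolding F_def R_def all_potent_iff[OF assms(3)] ..
  have finF: "finite (UNIV :: 'a set)" if F
    using that F7 unfolding R_def by simp
  have F1: "every_sum (M n) (idempotent_elem (M n)) (potent (M n) q)" if F for n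
    unfolding M_def using that finF[OF that] card[OF finF[OF that]] assms(4)
    by (intro every_matrix_idempotent_plus_potent) (auto simp: F_def)
  have F2: "every_sum (M n) (nilpotent_elem (M n)) (potent (M n) q)" if F for n
    unfolding M_def using that finF[OF that] assms(4)
    by (intro every_matrix_nilpotent_plus_potent) (auto simp: F_def)
  have 13: "every_sum (M n) (tripotent_elem (M n)) (potent (M n) q)"
    if "every_sum (M n) (idempotent_elem (M n)) (potent (M n) q)" for n
    by (rule ring.every_sum_tripotent_if_idempotent[OF ring_M that])
  have 14: "every_sum_or_diff (M n) (potent (M n) q) (idempotent_elem (M n))"
    if "every_sum (M n) (idempotent_elem (M n)) (potent (M n) q)" for n
    by (rule ring.every_sum_or_diff_if_idempotent[OF ring_M that])
  have 43: "every_sum (M n) (tripotent_elem (M n)) (potent (M n) q)"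
    if "every_sum_or_diff (M n) (potent (M n) q) (idempotent_elem (M n))" for n
    by (rule ring.every_sum_tripotent_if_sum_or_diff[OF ring_M that])
  have 3: F if "n > 0" "every_sum (M n) (tripotent_elem (M n)) (potent (M n) q)" for n
    using covF covered_if_matrix_tripotent_sum[OF that[unfolded M_def]] unfolding cov_def by blast
  have 2: F if "n > 0" "every_sum (M n) (nilpotent_elem (M n)) (potent (M n) q)" for n
    using potent_if_matrix_nilpotent_sum[OF that[unfolded M_def]] unfolding F_def by blast
  have scalar: F if "every_sum R (tripotent_elem R) (potent R q)"
    using covF covered_if_tripotent_sum[OF that[unfolded R_def]] unfolding cov_def by blast
  have 5: "every_sum R (potent R q) (tripotent_elem R) \<longleftrightarrow> F"
  proof
    assume *: "every_sum R (potent R q) (tripotent_elem R)"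
    have "every_sum R (tripotent_elem R) (potent R q)"
      unfolding every_sum_def
    proof
      fix a assume "a \<in> carrier R"
      then obtain x y where "potent R q x" "potent R 3 y" "a = x \<oplus>\<^bsub>R\<^esub> y"
        using * unfolding every_sum_def by blast
      moreover from this have "a = y \<oplus>\<^bsub>R\<^esub> x" by (auto simp: potent_def R.a_comm)
      ultimately show "\<exists>x y. potent R 3 x \<and> potent R q y \<and> a = x \<oplus>\<^bsub>R\<^esub> y" by blast
    qed
    then show F by (rule scalar)
  next
    assume F
    have "potent R q a \<and> tripotent_elem R 0 \<and> a = a \<oplus>\<^bsub>R\<^esub> 0" for a
      using \<open>F\<close> by (simp add: R_def F_def)
    then show "every_sum R (potent R q) (tripotent_elem R)"
      unfolding every_sum_def by blast
  qed
  have 6: "every_sum_or_diff R (potent R q) (idempotent_elem R) \<longleftrightarrow> F"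
  proof
    assume "every_sum_or_diff R (potent R q) (idempotent_elem R)"
    then show F by (intro scalar R.every_sum_tripotent_if_sum_or_diff)
  next
    assume F
    have "potent R q a \<and> idempotent_elem R 0 \<and> a = a \<oplus>\<^bsub>R\<^esub> 0" for a
      using \<open>F\<close> by (simp add: R_def F_def)
    then show "every_sum_or_diff R (potent R q) (idempotent_elem R)"
      unfolding every_sum_or_diff_def by blast
  qed
  have each_some: "((\<forall>n>0. P n) \<longleftrightarrow> F) \<and> ((\<exists>n>0. P n) \<longleftrightarrow> F)"
    if "\<And>n. F \<Longrightarrow> P n" "\<And>n. n > 0 \<Longrightarrow> P n \<Longrightarrow> F" for P :: "nat \<Rightarrow> bool"
    using that zero_less_Suc[of 0] by blast
  \<comment> \<open>Each condition on matrices follows from \<open>F\<close> for all sizes and implies \<open>F\<close> for a single positive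
    size, so both quantified versions are equivalent to \<open>F\<close>.\<close>
  note e1 = each_some[of "\<lambda>n. every_sum (M n) (idempotent_elem (M n)) (potent (M n) q)",
      OF F1 3[OF _ 13]]
  note e2 = each_some[of "\<lambda>n. every_sum (M n) (nilpotent_elem (M n)) (potent (M n) q)", OF F2 2]
  note e3 = each_some[of "\<lambda>n. every_sum (M n) (tripotent_elem (M n)) (potent (M n) q)",
      OF 13[OF F1] 3]
  note e4 = each_some[of "\<lambda>n. every_sum_or_diff (M n) (potent (M n) q) (idempotent_elem (M n))",
      OF 14[OF F1] 3[OF _ 43]]
  show ?thesis
    using e1 e2 e3 e4 5 6 F7 unfolding all_equivalent_def by simp
qed

end
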